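(* Let $(\sigma_t)_{t\ge0}$ be a Markov process and $(\mathcal F_t)$ its adapted filtration. Let $(X_i)_{i\ge1}$ be real random variables satisfying the following hypotheses. 1. (a) $\sup_\sigma\sup_{n\in\mathbb N}\mathbb E_\sigma[X_n^2]<\infty$; (b) for every $i\ge1$, $X_i$ is measurable with respect to $\mathcal F_i$; (c) for every $k,n\ge1$, every measurable $f:\mathbb R^n\to\mathbb R$ such that $\sup_\sigma\mathbb E_\sigma[f(X_1,\dots,X_n)]<\infty$, and every initial $\sigma$, $$\mathbb E_\sigma[f(X_k,\dots,X_{k+n-1})\mid\mathcal F_{k-1}]=\mathbb E_{\sigma_{k-1}}[f(X_1,\dots,X_n)].$$ 2. There exist a decreasing function $\Phi$, constants $C,c^*\ge1$, $v\in\mathbb R$ and a probability measure $\nu$ on the state space such that (a) $\lim_{n\to\infty}e^{(\log n)^2}\Phi(n)=0$; (b) for every $i\ge1$, $\mathbb E_\nu[X_i]=v$; (c) for every $f:\mathbb R\to\mathbb R$ such that $e^{-|x|}f(x)\in L^1(\mathbb R)$ there is a constant $C_f$ such that for every $k\ge1$, $\sup_\sigma|\mathbb E_\sigma[f(X_k)]-\mathbb E_\nu[f(X_1)]|\le C_f\Phi(k)$; (d) for every $k,n\ge1$ such that $k\ge c^*n$, $\sup_\sigma|\mathbb E_\sigma[X_kX_{k+n}]-\mathbb E_\nu[X_1X_{n+1}]|\le C\Phi(k)$; (e) for every $k,n\ge1$ such that $k>c^*n$ and any bounded measurable function $F:\mathbb R^n\to\mathbb R$, $\sup_\sigma|\mathbb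 E_\sigma[F(X_k,\dots,X_{k+n-1})]-\mathbb E_\nu[F(X_1,\dots,X_n)]|\le C\|F\|_\infty\Phi(k)$. Then there exists $s\ge0$ such that, for every initial $\sigma$, under $\mathbb P_\sigma$, $$\frac{\sum_{i=1}^nX_i-vn}{\sqrt n}\xrightarrow[n\to\infty]{\text{law}}\mathcal N(0,s^2).$$
   Context: $\mathbb P_\sigma,\mathbb E_\sigma$ denote probability and expectation when the Markov process starts from the state $\sigma$; $\sup_\sigma$ is over all initial states; $\mathbb E_\nu$ is the expectation when the initial state has law $\nu$. $\mathbb N$ is the set of positive integers. $\mathcal N(0,0)$ is the Dirac mass at $0$. All functions $f$, $F$ are measurable. *)

theory Defs
  imports "HOL-Probability.Probability"
begin

text \<open>
  The filtration generated by a process \<open>Z\<close> on \<open>\<Omega>\<close> with values in \<open>S\<close>: its member at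
  time \<open>t\<close> is generated by the variables \<open>Z u\<close> with \<open>0 \<le> u \<le> t\<close>.
\<close>
definition natural_filtration ::
  "'w measure \<Rightarrow> 's measure \<Rightarrow> (real \<Rightarrow> 'w \<Rightarrow> 's) \<Rightarrow> real \<Rightarrow> 'w measure" where
  "natural_filtration \<Omega> S Z t =
     sigma (space \<Omega>) {Z u -` A \<inter> space \<Omega> | u A. u \<in> {0..t} \<and> A \<in> sets S}"

text \<open>
  A time-homogeneous Markov process in continuous time, given as a family of laws \<open>P x\<close>
  on one sample space, indexed by the initial state \<open>x\<close>. Only the \<open>\<sigma>\<close>-algebra of \<open>\<Omega>\<close>
  matters, not the measure it carries. Values \<open>Z t\<close> with \<open>t < 0\<close> play no role.
\<close>
locale markov_process =
  fixes S :: "'s measure"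
    and \<Omega> :: "'w measure"
    and P :: "'s \<Rightarrow> 'w measure"
    and Z :: "real \<Rightarrow> 'w \<Rightarrow> 's"
  assumes kernel: "P \<in> S \<rightarrow>\<^sub>M prob_algebra \<Omega>"
    and process_measurable: "\<And>t. 0 \<le> t \<Longrightarrow> Z t \<in> \<Omega> \<rightarrow>\<^sub>M S"
    and start: "\<And>x. x \<in> space S \<Longrightarrow> AE \<omega> in P x. Z 0 \<omega> = x"
    and markov: "\<And>x t h A. x \<in> space S \<Longrightarrow> 0 \<le> t \<Longrightarrow> 0 \<le> h \<Longrightarrow> A \<in> sets S \<Longrightarrow>
      AE \<omega> in P x.
        real_cond_exp (P x) (natural_filtration \<Omega> S Z t)
          (indicator (Z (t + h) -` A \<inter> space \<Omega>)) \<omega>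
        = measure (P (Z t \<omega>)) (Z h -` A \<inter> space \<Omega>)"

text \<open>
  Measurable functions on \<open>n\<close>-dimensional space are functions measurable on the product of
  the Borel spaces over the index set \<open>{..<n}\<close>, whose points are the functions that are
  \<open>undefined\<close> outside \<open>{..<n}\<close>.
\<close>
abbreviation borel_pow :: "nat \<Rightarrow> (nat \<Rightarrow> real) measure" where
  "borel_pow n \<equiv> Pi\<^sub>M {..<n} (\<lambda>_. borel)"

text \<open>The random vector with components \<open>X k, \<dots>, X (k + n - 1)\<close>.\<close>
definition block :: "(nat \<Rightarrow> 'w \<Rightarrow> real) \<Rightarrow> nat \<Rightarrow> nat \<Rightarrow> 'w \<Rightarrow> nat \<Rightarrow> real" where
  "block X k n \<omega> = (\<lambda>i\<in>{..<n}. X (k + i) \<omega>)"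

text \<open>
  The parameter \<open>s\<close> is the standard deviation. The value at \<open>s = 0\<close> needs a separate clause
  because \<open>normal_density \<mu> 0\<close> vanishes identically.
\<close>
definition normal_law :: "real \<Rightarrow> real \<Rightarrow> real measure" where
  "normal_law \<mu> s =
     (if s = 0 then return borel \<mu> else density lborel (\<lambda>x. ennreal (normal_density \<mu> s x)))"

end

theory Submission
  imports Defs "HOL-Real_Asymp.Real_Asymp"
begin

text \<open>
  The proof follows the characteristic function of the centred partial sums \<open>Y 1 + \<dots> + Y n\<close>,
  where \<open>Y i = X i - v\<close>, as one summand after the other is added. Fix \<open>t\<close>, put
  \<open>\<tau> = t / sqrt N\<close> and let \<open>\<phi> n\<close> be the expectation of
  \<open>wave n = exp (\<i> \<tau> (Y 1 + \<dots> + Y n))\<close>. A Taylor expansion in the last summand gives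
  \<open>\<phi> n - \<phi> (n - 1) = \<i> \<tau> E (wave (n - 1) Y n) - \<tau>\<^sup>2 / 2 E (wave (n - 1) (Y n)\<^sup>2) + O(\<bar>\<tau>\<bar>\<^sup>3)\<close>.
  The linear term is handled by removing \<open>Y (n - 1), Y (n - 2), \<dots>, Y (n - g)\<close> from the wave one at
  a time: each removal contributes \<open>\<i> \<tau> E (wave (n - j - 1) Y (n - j) Y n)\<close>, up to \<open>O(\<tau>\<^sup>2)\<close>, and
  what remains is negligible because the conditional mean of \<open>Y n\<close> given the past up to time
  \<open>n - g - 1\<close> is nearly \<open>0\<close>. In every term with a product \<open>Y (n - j) Y n\<close> the wave may be moved
  back to time \<open>n - (c + 1) g\<close>, where \<open>c\<close> is rounded up to an integer; given the past up to that time, the conditional mean of the product is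
  nearly a constant \<open>\<gamma> j\<close>. This yields
  \<open>\<phi> n = (1 - \<tau>\<^sup>2 \<sigma>\<^sup>2 / 2) \<phi> (n - 1) + error\<close> with \<open>\<sigma>\<^sup>2 = \<gamma> 0 + 2 (\<gamma> 1 + \<gamma> 2 + \<dots>)\<close>
  (lemma \<open>\<phi>_recursion\<close>). With \<open>g\<close> close to \<open>N powr (1/8)\<close> the errors of the \<open>N\<close> steps add up to
  \<open>o(1)\<close>, so \<open>\<phi> N\<close> tends to \<open>exp (- t\<^sup>2 \<sigma>\<^sup>2 / 2)\<close> (lemma \<open>\<phi>_tendsto\<close>), and the continuity theorem of
  Levy applies (theorem \<open>central_limit\<close>).

  Only a single summand or a pair of summands is ever decoupled from the past. The mixing rate enters
  through \<open>n ^ 5 * \<Phi> n \<longlonglongrightarrow> 0\<close>, and the sums over long blocks need no decoupling. The hypotheses on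
  conditional moments follow from the Markov property, which restarts the process at the state
  occupied at time \<open>m\<close>, and from the bounds on one and two coordinates, which are uniform in the
  initial state. Third moments are finite and uniformly bounded because a function of cubic growth is
  integrable against \<open>exp (- \<bar>y\<bar>)\<close>. The constants \<open>\<gamma> j\<close>, hence the limiting variance, do not depend
  on the initial state.
\<close>

section \<open>Elementary estimates and conditional expectations\<close>

text \<open>
  If \<open>\<phi>\<close> satisfies \<open>\<phi> (n + 1) = q \<phi> n\<close> up to an error \<open>e n\<close> at step \<open>n\<close>, then \<open>\<phi> N\<close> is close to the
  exact solution. The ratio \<open>q\<close> may exceed \<open>1\<close> in absolute value, which matters as long as the
  limiting variance is not known to be nonnegative.
\<close>
lemma perturbed_geometric_recursion:
  fixes \<phi> :: "nat \<Rightarrow> complex" and q :: real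
  assumes "\<And>n. n < N \<Longrightarrow> norm (\<phi> (Suc n) - q * \<phi> n) \<le> e n"
  shows "norm (\<phi> N - q ^ N * \<phi> 0) \<le> max 1 \<bar>q\<bar> ^ N * (\<Sum>n<N. e n)"
  using assms
proof (induction N)
  case 0
  then show ?case by simp
next
  case (Suc N)
  let ?m = "max 1 \<bar>q\<bar>"
  have e0: "0 \<le> e n" if "n < Suc N" for n
    using Suc.prems[OF that] norm_ge_zero order_trans by blast
  have IH: "norm (\<phi> N - q ^ N * \<phi> 0) \<le> ?m ^ N * (\<Sum>n<N. e n)"
    using Suc by simp
  have "\<phi> (Suc N) - q ^ Suc N * \<phi> 0 = (\<phi> (Suc N) - q * \<phi> N) + q * (\<phi> N - q ^ N * \<phi> 0)"
    by (simp add: algebra_simps)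
  also have "norm \<dots> \<le> norm (\<phi> (Suc N) - q * \<phi> N) + norm (q * (\<phi> N - q ^ N * \<phi> 0))"
    by (rule norm_triangle_ineq)
  also have "\<dots> \<le> 1 * e N + \<bar>q\<bar> * (?m ^ N * (\<Sum>n<N. e n))"
    using Suc.prems[of N] IH by (auto simp: norm_mult intro!: add_mono mult_left_mono)
  also have "\<dots> \<le> ?m ^ Suc N * e N + ?m * (?m ^ N * (\<Sum>n<N. e n))"
    using e0 by (intro add_mono mult_right_mono one_le_power mult_nonneg_nonneg sum_nonneg) auto
  also have "\<dots> = ?m ^ Suc N * (\<Sum>n<Suc N. e n)"
    by (simp add: algebra_simps)
  finally show ?case .
qed

lemma abs_triple_product_le: "\<bar>a * b * c\<bar> \<le> \<bar>a\<bar> ^ 3 + \<bar>b\<bar> ^ 3 + \<bar>c\<bar> ^ 3" for a b c :: real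
proof -
  define m where "m = max \<bar>a\<bar> (max \<bar>b\<bar> \<bar>c\<bar>)"
  have "\<bar>a * b * c\<bar> \<le> m * m * m"
    unfolding abs_mult m_def by (intro mult_mono) auto
  also have "\<dots> = m ^ 3"
    by (simp add: power3_eq_cube)
  also have "\<dots> \<le> \<bar>a\<bar> ^ 3 + \<bar>b\<bar> ^ 3 + \<bar>c\<bar> ^ 3"
    unfolding m_def max_def by auto
  finally show ?thesis .
qed

lemma integral_norm_le_integral:
  fixes f :: "'a \<Rightarrow> 'b :: {banach, second_countable_topology}"
  assumes "integrable M f" "integrable M h" "\<And>\<omega>. norm (f \<omega>) \<le> h \<omega>"
  shows "norm (\<integral>\<omega>. f \<omega> \<partial>M) \<le> (\<integral>\<omega>. h \<omega> \<partial>M)"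
  using assms by (intro order_trans[OF integral_norm_bound] integral_mono integrable_norm)

text \<open>
  A variable \<open>W\<close> whose conditional expectation is within \<open>\<epsilon>\<close> of a constant \<open>w\<close> decouples from
  every complex variable of the conditioning \<open>\<sigma>\<close>-algebra that is bounded by \<open>1\<close>.
\<close>
lemma (in prob_space) cond_exp_nearly_constant:
  fixes U :: "'a \<Rightarrow> complex"
  assumes F: "subalgebra M F"
    and U: "U \<in> borel_measurable F" "\<And>\<omega>. norm (U \<omega>) \<le> 1"
    and W: "integrable M W"
    and w: "AE \<omega> in M. \<bar>real_cond_exp M F W \<omega> - w\<bar> \<le> \<epsilon>"
  shows "norm (expectation (\<lambda>\<omega>. U \<omega> * complex_of_real (W \<omega>)) - w * expectation U) \<le> \<epsilon>"
proof -
  interpret finite_measure_subalgebra M F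
    by unfold_locales (rule F)
  let ?V = "real_cond_exp M F W"
  have UM [measurable]: "U \<in> borel_measurable M"
    by (rule measurable_from_subalg[OF F U(1)])
  note [measurable] = U(1) borel_measurable_integrable[OF W]
  have V: "integrable M ?V"
    using W by (rule real_cond_exp_int)
  have bd: "integrable M (\<lambda>\<omega>. U \<omega> * complex_of_real (f \<omega>))" if "integrable M f" for f
    using that by (intro Bochner_Integration.integrable_bound[OF that] AE_I2)
      (auto simp: norm_mult U(2) mult_left_le_one_le)
  have U_int: "integrable M U"
    using bd[of "\<lambda>_. 1"] by simp
  have part: "expectation (\<lambda>\<omega>. p (U \<omega>) * ?V \<omega>) = expectation (\<lambda>\<omega>. p (U \<omega>) * W \<omega>)
      \<and> integrable M (\<lambda>\<omega>. p (U \<omega>) * ?V \<omega>) \<and> integrable M (\<lambda>\<omega>. p (U \<omega>) * W \<omega>)"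
    if p: "p = Re \<or> p = Im" for p :: "complex \<Rightarrow> real"
  proof -
    have [measurable]: "p \<in> borel_measurable borel"
      using p by auto
    have "\<bar>p (U \<omega>)\<bar> \<le> 1" for \<omega>
      using p abs_Re_le_cmod[of "U \<omega>"] abs_Im_le_cmod[of "U \<omega>"] U(2)[of \<omega>] by auto
    then have "\<bar>p (U \<omega>)\<bar> * \<bar>W \<omega>\<bar> \<le> \<bar>W \<omega>\<bar>" for \<omega>
      using mult_right_mono[of "\<bar>p (U \<omega>)\<bar>" 1 "\<bar>W \<omega>\<bar>"] by simp
    then have "integrable M (\<lambda>\<omega>. p (U \<omega>) * W \<omega>)"
      using W by (intro Bochner_Integration.integrable_bound[OF W]) (auto simp: abs_mult)
    then show ?thesis
      using real_cond_exp_intg[of "\<lambda>\<omega>. p (U \<omega>)" W] by auto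
  qed
  \<comment> \<open>Conditional expectations are real valued, hence the passage to real and imaginary parts.\<close>
  have split: "U \<omega> * complex_of_real x = complex_of_real (Re (U \<omega>) * x) + \<i> * complex_of_real (Im (U \<omega>) * x)"
    for \<omega> x by (auto simp: complex_eq_iff)
  have "expectation (\<lambda>\<omega>. U \<omega> * complex_of_real (W \<omega>)) = expectation (\<lambda>\<omega>. U \<omega> * complex_of_real (?V \<omega>))"
    unfolding split using part[of Re] part[of Im] by (simp del: of_real_mult)
  then have "expectation (\<lambda>\<omega>. U \<omega> * complex_of_real (W \<omega>)) - w * expectation U
      = expectation (\<lambda>\<omega>. U \<omega> * complex_of_real (?V \<omega> - w))"
    using bd[OF V] U_int by (simp add: algebra_simps)
  also have "norm \<dots> \<le> expectation (\<lambda>\<omega>. norm (U \<omega> * complex_of_real (?V \<omega> - w)))"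
    by (rule integral_norm_bound)
  also have "\<dots> \<le> expectation (\<lambda>\<omega>. \<epsilon>)"
  proof (rule integral_mono_AE)
    show "integrable M (\<lambda>\<omega>. norm (U \<omega> * complex_of_real (?V \<omega> - w)))"
      using V by (intro integrable_norm bd) auto
    show "AE \<omega> in M. norm (U \<omega> * complex_of_real (?V \<omega> - w)) \<le> \<epsilon>"
      using w
    proof eventually_elim
      case (elim \<omega>)
      have "norm (U \<omega>) * \<bar>?V \<omega> - w\<bar> \<le> 1 * \<epsilon>"
        using elim U(2)[of \<omega>] by (intro mult_mono) auto
      then show ?case
        by (simp add: norm_mult flip: of_real_diff)
    qed
  qed auto
  finally show ?thesis
    by (simp add: prob_space)
qed

text \<open>
  The length \<open>g\<close> of the window of past summands that are removed from the wave when \<open>N\<close> summands are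
  added in total. The square of the gap has to be of smaller order than \<open>sqrt N\<close>, while a rate of
  order \<open>o(1 / g ^ 5)\<close> must still be of smaller order than \<open>1 / sqrt N\<close>.
\<close>
definition gap :: "nat \<Rightarrow> nat" where
  "gap N = nat \<lfloor>real N powr (1/8)\<rfloor>"

lemma gap_asymptotics:
  "filterlim gap at_top sequentially"
  "(\<lambda>N. real (gap N) / sqrt (real N)) \<longlonglongrightarrow> 0"
  "(\<lambda>N. (real (gap N))\<^sup>2 / sqrt (real N)) \<longlonglongrightarrow> 0"
  "\<forall>\<^sub>F N in sequentially. sqrt (real N) \<le> 2 * real (gap N) ^ 5"
proof -
  have gap: "real (gap N) = real_of_int \<lfloor>real N powr (1/8)\<rfloor>" for N
    unfolding gap_def by simp
  have "filterlim (\<lambda>N. real (gap N)) at_top sequentially"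
    unfolding gap by real_asymp
  then show "filterlim gap at_top sequentially"
    unfolding filterlim_sequentially_iff_filterlim_real .
  show "(\<lambda>N. real (gap N) / sqrt (real N)) \<longlonglongrightarrow> 0"
    unfolding gap by real_asymp
  show "(\<lambda>N. (real (gap N))\<^sup>2 / sqrt (real N)) \<longlonglongrightarrow> 0"
    unfolding gap by real_asymp
  show "\<forall>\<^sub>F N in sequentially. sqrt (real N) \<le> 2 * real (gap N) ^ 5"
    unfolding gap by real_asymp
qed

section \<open>Sequences with nearly deterministic conditional moments\<close>

text \<open>
  A sequence adapted to a filtration, with bounded third moments, such that the conditional mean of one
  term and of a product of two terms, given a sufficiently remote past, is within \<open>r k\<close> of the
  constants \<open>0\<close> and \<open>\<gamma> j\<close>; here \<open>k\<close> is the distance to the past and \<open>j\<close> the distance between the two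
  terms. For products the past must be at least \<open>c\<close> times as far away as the two terms are from each
  other. The monotonicity of the filtration is only needed in the form of \<open>adapted\<close>. Terms are
  indexed from \<open>1\<close>, and \<open>F m\<close> is the past up to and including \<open>Y m\<close>.
\<close>
locale weakly_dependent_sequence = prob_space M for M :: "'a measure" +
  fixes F :: "nat \<Rightarrow> 'a measure"
    and Y :: "nat \<Rightarrow> 'a \<Rightarrow> real"
    and \<gamma> r :: "nat \<Rightarrow> real"
    and B :: real
    and c :: nat
  assumes filtration: "\<And>m. subalgebra M (F m)"
    and adapted: "\<And>i m. 1 \<le> i \<Longrightarrow> i \<le> m \<Longrightarrow> Y i \<in> borel_measurable (F m)"
    and third_moment: "\<And>i. 1 \<le> i \<Longrightarrow> integrable M (\<lambda>\<omega>. \<bar>Y i \<omega>\<bar> ^ 3)"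
      "\<And>i. 1 \<le> i \<Longrightarrow> expectation (\<lambda>\<omega>. \<bar>Y i \<omega>\<bar> ^ 3) \<le> B"
    and B: "1 \<le> B"
    and c: "1 \<le> c"
    and cond_mean: "\<And>m k. 1 \<le> k \<Longrightarrow>
      AE \<omega> in M. \<bar>real_cond_exp M (F m) (Y (m + k)) \<omega>\<bar> \<le> r k"
    and cond_cov: "\<And>m k j. 1 \<le> k \<Longrightarrow> c * j \<le> k \<Longrightarrow>
      AE \<omega> in M. \<bar>real_cond_exp M (F m) (\<lambda>\<omega>. Y (m + k) \<omega> * Y (m + k + j) \<omega>) \<omega> - \<gamma> j\<bar> \<le> r k"
    and rate_antimono: "antimono_on {1..} r"
    and rate_nonneg: "\<And>k. 1 \<le> k \<Longrightarrow> 0 \<le> r k"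
    and rate_decay: "(\<lambda>k. real k ^ 5 * r k) \<longlonglongrightarrow> 0"
begin

text \<open>
  Variables that obey the same third moment bound as the terms of the sequence. The constant \<open>1\<close> is
  included because \<open>1 \<le> B\<close>, so that bounds on products of three such variables cover shorter products too.
\<close>
definition cubic :: "('a \<Rightarrow> real) \<Rightarrow> bool" where
  "cubic W \<longleftrightarrow> W \<in> borel_measurable M \<and> integrable M (\<lambda>\<omega>. \<bar>W \<omega>\<bar> ^ 3)
     \<and> expectation (\<lambda>\<omega>. \<bar>W \<omega>\<bar> ^ 3) \<le> B"

text \<open>
  The exponential of the partial sum with frequency \<open>\<tau>\<close>; its expectation \<open>\<phi>\<close> is the characteristic
  function of the partial sum at \<open>\<tau>\<close>.
\<close>
definition wave :: "real \<Rightarrow> nat \<Rightarrow> 'a \<Rightarrow> complex" where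
  "wave \<tau> n \<omega> = iexp (\<tau> * (\<Sum>i=1..n. Y i \<omega>))"

definition \<phi> :: "real \<Rightarrow> nat \<Rightarrow> complex" where
  "\<phi> \<tau> n = expectation (wave \<tau> n)"

lemma Y_measurable: "1 \<le> i \<Longrightarrow> Y i \<in> borel_measurable M"
  using adapted[of i i] measurable_from_subalg[OF filtration] by blast

lemma cubic_Y: "1 \<le> i \<Longrightarrow> cubic (Y i)"
  using third_moment Y_measurable unfolding cubic_def by auto

lemma cubic_one: "cubic (\<lambda>_. 1)"
  using B unfolding cubic_def by (auto simp: prob_space)

lemma cubic_product:
  assumes "cubic U" "cubic V" "cubic W"
  shows "integrable M (\<lambda>\<omega>. U \<omega> * V \<omega> * W \<omega>)"
    and "expectation (\<lambda>\<omega>. \<bar>U \<omega> * V \<omega> * W \<omega>\<bar>) \<le> 3 * B"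
proof -
  have [measurable]: "U \<in> borel_measurable M" "V \<in> borel_measurable M" "W \<in> borel_measurable M"
    using assms unfolding cubic_def by auto
  let ?h = "\<lambda>\<omega>. \<bar>U \<omega>\<bar> ^ 3 + \<bar>V \<omega>\<bar> ^ 3 + \<bar>W \<omega>\<bar> ^ 3"
  have h: "integrable M ?h"
    using assms unfolding cubic_def by auto
  show *: "integrable M (\<lambda>\<omega>. U \<omega> * V \<omega> * W \<omega>)"
  proof (rule Bochner_Integration.integrable_bound[OF h])
    show "AE \<omega> in M. norm (U \<omega> * V \<omega> * W \<omega>) \<le> norm (?h \<omega>)"
    proof (rule AE_I2)
      fix \<omega>
      have "\<bar>U \<omega> * V \<omega> * W \<omega>\<bar> \<le> ?h \<omega>"
        by (rule abs_triple_product_le)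
      then show "norm (U \<omega> * V \<omega> * W \<omega>) \<le> norm (?h \<omega>)"
        by simp
    qed
  qed simp
  have "expectation (\<lambda>\<omega>. \<bar>U \<omega> * V \<omega> * W \<omega>\<bar>) \<le> expectation ?h"
    using * h abs_triple_product_le by (intro integral_mono) auto
  also have "\<dots> \<le> 3 * B"
    using assms unfolding cubic_def by simp
  finally show "expectation (\<lambda>\<omega>. \<bar>U \<omega> * V \<omega> * W \<omega>\<bar>) \<le> 3 * B" .
qed

lemma wave_adapted: "n \<le> m \<Longrightarrow> wave \<tau> n \<in> borel_measurable (F m)"
proof -
  assume "n \<le> m"
  then have [measurable]: "(\<lambda>\<omega>. \<Sum>i=1..n. Y i \<omega>) \<in> borel_measurable (F m)"
    using adapted by (intro borel_measurable_sum) auto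
  show ?thesis
    unfolding wave_def by measurable
qed

lemma wave_measurable [measurable]: "wave \<tau> n \<in> borel_measurable M"
  using wave_adapted[of n n] measurable_from_subalg[OF filtration] by blast

lemma norm_wave [simp]: "norm (wave \<tau> n \<omega>) = 1"
  unfolding wave_def by simp

lemma wave_Suc: "wave \<tau> (Suc n) \<omega> = wave \<tau> n \<omega> * iexp (\<tau> * Y (Suc n) \<omega>)"
  unfolding wave_def by (simp add: algebra_simps flip: exp_add)

lemma integrable_wave_mult:
  "integrable M W \<Longrightarrow> integrable M (\<lambda>\<omega>. wave \<tau> n \<omega> * complex_of_real (W \<omega>))"
  by (rule Bochner_Integration.integrable_bound[of M W]) (auto simp: norm_mult)

lemma integrable_wave: "integrable M (wave \<tau> n)"
  using integrable_wave_mult[of "\<lambda>_. 1"] by simp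

lemma rate_tendsto_0: "r \<longlonglongrightarrow> 0"
proof (rule tendsto_sandwich[OF _ _ tendsto_const rate_decay])
  show "\<forall>\<^sub>F n in sequentially. 0 \<le> r n"
    using rate_nonneg by (rule eventually_sequentiallyI)
  have "r n \<le> real n ^ 5 * r n" if "1 \<le> n" for n
    using rate_nonneg[OF that] that mult_right_mono[of 1 "real n ^ 5" "r n"] by auto
  then show "\<forall>\<^sub>F n in sequentially. r n \<le> real n ^ 5 * r n"
    by (rule eventually_sequentiallyI)
qed

lemma rate_mono: "1 \<le> k \<Longrightarrow> k \<le> l \<Longrightarrow> r l \<le> r k"
  using rate_antimono by (auto simp: monotone_on_def)

lemma integrable_Y: "1 \<le> i \<Longrightarrow> integrable M (Y i)"
  using cubic_product(1)[OF cubic_Y cubic_one cubic_one] by simp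

lemma integrable_YY: "1 \<le> i \<Longrightarrow> 1 \<le> j \<Longrightarrow> integrable M (\<lambda>\<omega>. Y i \<omega> * Y j \<omega>)"
  using cubic_product(1)[OF cubic_Y cubic_Y cubic_one] by simp

lemma wave_mean:
  assumes "1 \<le> k"
  shows "norm (expectation (\<lambda>\<omega>. wave \<tau> m \<omega> * complex_of_real (Y (m + k) \<omega>))) \<le> r k"
  using cond_exp_nearly_constant[OF filtration wave_adapted[OF order_refl, of \<tau> m] _ integrable_Y[of "m + k"], of 0 "r k"]
    cond_mean[OF assms, of m] assms by simp

lemma wave_cov:
  assumes "1 \<le> k" "c * j \<le> k"
  shows "norm (expectation (\<lambda>\<omega>. wave \<tau> m \<omega> * complex_of_real (Y (m + k) \<omega> * Y (m + k + j) \<omega>)) - \<gamma> j * \<phi> \<tau> m) \<le> r k"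
  using cond_exp_nearly_constant[OF filtration wave_adapted[OF order_refl, of \<tau> m] _ integrable_YY[of "m + k" "m + k + j"] cond_cov[OF assms, of m]]
   assms by (simp add: \<phi>_def)

lemma cov_tendsto: "(\<lambda>k. expectation (\<lambda>\<omega>. Y k \<omega> * Y (k + j) \<omega>)) \<longlonglongrightarrow> \<gamma> j"
proof (rule LIM_zero_cancel, rule Lim_null_comparison[OF _ rate_tendsto_0])
  have "norm (expectation (\<lambda>\<omega>. Y k \<omega> * Y (k + j) \<omega>) - \<gamma> j) \<le> r k" if "1 + c * j \<le> k" for k
  proof -
    have *: "wave 0 0 = (\<lambda>_. 1)" "\<phi> 0 0 = 1"
      unfolding wave_def \<phi>_def by (auto simp: prob_space)
    have "norm (complex_of_real (expectation (\<lambda>\<omega>. Y k \<omega> * Y (k + j) \<omega>) - \<gamma> j)) \<le> r k"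
      using wave_cov[of k j 0 0] that unfolding * by (simp del: of_real_mult norm_of_real)
    then show ?thesis
      by (simp only: norm_of_real real_norm_def)
  qed
  then show "\<forall>\<^sub>F k in sequentially. norm (expectation (\<lambda>\<omega>. Y k \<omega> * Y (k + j) \<omega>) - \<gamma> j) \<le> r k"
    by (rule eventually_sequentiallyI)
qed

lemma cov_le: "\<bar>\<gamma> j\<bar> \<le> 3 * B"
proof (rule tendsto_upperbound[OF tendsto_rabs[OF cov_tendsto]])
  have "\<bar>expectation (\<lambda>\<omega>. Y k \<omega> * Y (k + j) \<omega>)\<bar> \<le> 3 * B" if "1 \<le> k" for k
    using cubic_product(2)[OF cubic_Y[of k] cubic_Y[of "k + j"] cubic_one] that
    by (intro order_trans[OF integral_abs_bound]) simp
  then show "\<forall>\<^sub>F k in sequentially. \<bar>expectation (\<lambda>\<omega>. Y k \<omega> * Y (k + j) \<omega>)\<bar> \<le> 3 * B"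
    by (rule eventually_sequentiallyI)
qed simp

text \<open>
  Conditioning on the past up to \<open>Y k\<close> shows that the expectation of \<open>Y k * Y (k + j)\<close> is small
  when \<open>j\<close> is large, uniformly in \<open>k\<close>; as \<open>k\<close> grows, it tends to \<open>\<gamma> j\<close>.
\<close>
lemma cov_decay:
  assumes j: "1 \<le> j"
  shows "\<bar>\<gamma> j\<bar> \<le> 3 * B * r j"
proof (rule tendsto_upperbound[OF tendsto_rabs[OF cov_tendsto]])
  have "\<bar>expectation (\<lambda>\<omega>. Y k \<omega> * Y (k + j) \<omega>)\<bar> \<le> 3 * B * r j" if k: "1 \<le> k" for k
  proof -
    interpret finite_measure_subalgebra M "F k"
      by unfold_locales (rule filtration)
    let ?V = "real_cond_exp M (F k) (Y (k + j))"
    have V: "integrable M (\<lambda>\<omega>. Y k \<omega> * ?V \<omega>)"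
      "expectation (\<lambda>\<omega>. Y k \<omega> * ?V \<omega>) = expectation (\<lambda>\<omega>. Y k \<omega> * Y (k + j) \<omega>)"
      using real_cond_exp_intg[of "Y k" "Y (k + j)"] integrable_YY[of k "k + j"] k
        adapted[of k k] Y_measurable[of "k + j"] by auto
    have "\<bar>expectation (\<lambda>\<omega>. Y k \<omega> * ?V \<omega>)\<bar> \<le> expectation (\<lambda>\<omega>. \<bar>Y k \<omega> * ?V \<omega>\<bar>)"
      by (rule integral_abs_bound)
    also have "\<dots> \<le> expectation (\<lambda>\<omega>. \<bar>Y k \<omega>\<bar> * r j)"
    proof (rule integral_mono_AE)
      show "AE \<omega> in M. \<bar>Y k \<omega> * ?V \<omega>\<bar> \<le> \<bar>Y k \<omega>\<bar> * r j"
        using cond_mean[OF j, of k] by eventually_elim (auto simp: abs_mult intro: mult_left_mono)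
    qed (use V integrable_Y[of k] k in auto)
    also have "\<dots> \<le> 3 * B * r j"
      using cubic_product(2)[OF cubic_Y[of k] cubic_one cubic_one] k rate_nonneg[OF j]
      by (auto intro: mult_right_mono)
    finally show ?thesis
      unfolding V(2) .
  qed
  then show "\<forall>\<^sub>F k in sequentially. \<bar>expectation (\<lambda>\<omega>. Y k \<omega> * Y (k + j) \<omega>)\<bar> \<le> 3 * B * r j"
    by (rule eventually_sequentiallyI)
qed simp

lemma summable_cov: "summable (\<lambda>j. \<gamma> (Suc j))"
proof (rule summable_comparison_test_ev)
  have "\<forall>\<^sub>F k in sequentially. real k ^ 5 * r k < 1"
    using order_tendstoD(2)[OF rate_decay, of 1] by simp
  then have "\<forall>\<^sub>F k in sequentially. \<bar>\<gamma> k\<bar> \<le> 3 * B * inverse (real k ^ 5)"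
    using eventually_ge_at_top[of 1]
  proof eventually_elim
    case (elim k)
    have "r k \<le> inverse (real k ^ 5)"
      using elim by (simp add: field_simps)
    then have "3 * B * r k \<le> 3 * B * inverse (real k ^ 5)"
      using B by (intro mult_left_mono) auto
    then show ?case
      using cov_decay[OF elim(2)] by linarith
  qed
  then show "\<forall>\<^sub>F k in sequentially. norm (\<gamma> (Suc k)) \<le> 3 * B * inverse (real (Suc k) ^ 5)"
    by (subst (asm) eventually_sequentially_Suc[symmetric]) simp
  show "summable (\<lambda>k. 3 * B * inverse (real (Suc k) ^ 5))"
    using inverse_power_summable[of 5, where 'a = real]
    by (intro summable_mult) (subst summable_Suc_iff, simp)
qed

section \<open>The recursion for the characteristic functions\<close>

lemma norm_\<phi>_le: "norm (\<phi> \<tau> n) \<le> 1"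
  unfolding \<phi>_def using integral_norm_bound[of M "wave \<tau> n"] by (simp add: prob_space)

lemma wave_decouple_Suc:
  assumes "cubic U" "cubic V"
  shows "norm (expectation (\<lambda>\<omega>. wave \<tau> (Suc n) \<omega> * complex_of_real (U \<omega> * V \<omega>))
      - expectation (\<lambda>\<omega>. wave \<tau> n \<omega> * complex_of_real (U \<omega> * V \<omega>))) \<le> \<bar>\<tau>\<bar> * (3 * B)"
proof -
  have UV: "integrable M (\<lambda>\<omega>. U \<omega> * V \<omega>)"
    using cubic_product(1)[OF assms cubic_one] by simp
  have Y: "cubic (Y (Suc n))"
    by (rule cubic_Y) simp
  have "expectation (\<lambda>\<omega>. wave \<tau> (Suc n) \<omega> * complex_of_real (U \<omega> * V \<omega>))
      - expectation (\<lambda>\<omega>. wave \<tau> n \<omega> * complex_of_real (U \<omega> * V \<omega>))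
      = expectation (\<lambda>\<omega>. wave \<tau> (Suc n) \<omega> * complex_of_real (U \<omega> * V \<omega>)
          - wave \<tau> n \<omega> * complex_of_real (U \<omega> * V \<omega>))"
    using integrable_wave_mult[OF UV] by (intro Bochner_Integration.integral_diff[symmetric])
  also have "norm \<dots> \<le> expectation (\<lambda>\<omega>. \<bar>\<tau>\<bar> * \<bar>U \<omega> * V \<omega> * Y (Suc n) \<omega>\<bar>)"
  proof (rule integral_norm_le_integral)
    show "norm (wave \<tau> (Suc n) \<omega> * complex_of_real (U \<omega> * V \<omega>) - wave \<tau> n \<omega> * complex_of_real (U \<omega> * V \<omega>))
        \<le> \<bar>\<tau>\<bar> * \<bar>U \<omega> * V \<omega> * Y (Suc n) \<omega>\<bar>" for \<omega>
    proof -
      let ?y = "Y (Suc n) \<omega>"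
      have "wave \<tau> (Suc n) \<omega> * complex_of_real (U \<omega> * V \<omega>) - wave \<tau> n \<omega> * complex_of_real (U \<omega> * V \<omega>)
          = wave \<tau> n \<omega> * complex_of_real (U \<omega> * V \<omega>) * (iexp (\<tau> * ?y) - 1)"
        by (simp add: wave_Suc algebra_simps)
      also have "norm \<dots> = \<bar>U \<omega> * V \<omega>\<bar> * norm (iexp (\<tau> * ?y) - 1)"
        by (simp add: norm_mult abs_mult)
      also have "\<dots> \<le> \<bar>U \<omega> * V \<omega>\<bar> * \<bar>\<tau> * ?y\<bar>"
        using iexp_approx1[of "\<tau> * ?y" 0] by (intro mult_left_mono) auto
      finally show ?thesis
        by (simp add: abs_mult mult_ac)
    qed
  qed (use integrable_wave_mult[OF UV] cubic_product(1)[OF assms Y] in auto)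
  also have "\<dots> \<le> \<bar>\<tau>\<bar> * (3 * B)"
    using cubic_product(2)[OF assms Y] by (simp add: mult_left_mono)
  finally show ?thesis .
qed

text \<open>
  Moving the wave back in time under an expectation costs at most \<open>O(\<bar>\<tau>\<bar>)\<close> per time step.
\<close>
lemma wave_decouple:
  assumes "cubic U" "cubic V" "m \<le> p"
  shows "norm (expectation (\<lambda>\<omega>. wave \<tau> p \<omega> * complex_of_real (U \<omega> * V \<omega>))
      - expectation (\<lambda>\<omega>. wave \<tau> m \<omega> * complex_of_real (U \<omega> * V \<omega>))) \<le> \<bar>\<tau>\<bar> * real (p - m) * (3 * B)"
  using assms(3)
proof (induction p rule: dec_induct)
  case (step p)
  show ?case
    using norm_triangle_mono[OF wave_decouple_Suc[OF assms(1,2), of \<tau> p] step.IH] step.hyps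
    by (simp add: Suc_diff_le algebra_simps)
qed simp

lemma \<phi>_decouple: "m \<le> p \<Longrightarrow> norm (\<phi> \<tau> p - \<phi> \<tau> m) \<le> \<bar>\<tau>\<bar> * real (p - m) * (3 * B)"
  using wave_decouple[OF cubic_one cubic_one, of m p \<tau>] by (simp add: \<phi>_def)

text \<open>
  First-order expansion of the last factor of the wave in the presence of a weight \<open>W\<close>. The expansion
  of \<open>\<phi>\<close> itself has to be carried to second order.
\<close>
lemma wave_increment:
  assumes "cubic W"
  shows "norm (expectation (\<lambda>\<omega>. wave \<tau> (Suc n) \<omega> * complex_of_real (W \<omega>))
      - expectation (\<lambda>\<omega>. wave \<tau> n \<omega> * complex_of_real (W \<omega>))
      - \<i> * \<tau> * expectation (\<lambda>\<omega>. wave \<tau> n \<omega> * complex_of_real (Y (Suc n) \<omega> * W \<omega>))) \<le> \<tau>\<^sup>2 * (3 * B)"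
proof -
  let ?y = "Y (Suc n)"
  have Y: "cubic ?y"
    by (rule cubic_Y) simp
  have W: "integrable M W"
    using cubic_product(1)[OF assms cubic_one cubic_one] by simp
  have YW: "integrable M (\<lambda>\<omega>. ?y \<omega> * W \<omega>)"
    using cubic_product(1)[OF Y assms cubic_one] by simp
  let ?d = "\<lambda>\<omega>. wave \<tau> (Suc n) \<omega> * complex_of_real (W \<omega>) - wave \<tau> n \<omega> * complex_of_real (W \<omega>)
      - \<i> * \<tau> * (wave \<tau> n \<omega> * complex_of_real (?y \<omega> * W \<omega>))"
  note int = integrable_wave_mult[OF W] integrable_wave_mult[OF YW]
  have "expectation (\<lambda>\<omega>. wave \<tau> (Suc n) \<omega> * complex_of_real (W \<omega>))
      - expectation (\<lambda>\<omega>. wave \<tau> n \<omega> * complex_of_real (W \<omega>))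
      - \<i> * \<tau> * expectation (\<lambda>\<omega>. wave \<tau> n \<omega> * complex_of_real (?y \<omega> * W \<omega>)) = expectation ?d"
    using int by (simp del: of_real_mult)
  also have "norm \<dots> \<le> expectation (\<lambda>\<omega>. \<tau>\<^sup>2 * \<bar>?y \<omega> * ?y \<omega> * W \<omega>\<bar>)"
  proof (rule integral_norm_le_integral)
    show "norm (?d \<omega>) \<le> \<tau>\<^sup>2 * \<bar>?y \<omega> * ?y \<omega> * W \<omega>\<bar>" for \<omega>
    proof -
      have "?d \<omega> = wave \<tau> n \<omega> * complex_of_real (W \<omega>) * (iexp (\<tau> * ?y \<omega>) - (1 + \<i> * (\<tau> * ?y \<omega>)))"
        by (simp add: wave_Suc algebra_simps)
      also have "norm \<dots> = \<bar>W \<omega>\<bar> * norm (iexp (\<tau> * ?y \<omega>) - (1 + \<i> * (\<tau> * ?y \<omega>)))"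
        by (simp add: norm_mult)
      also have "\<dots> \<le> \<bar>W \<omega>\<bar> * (\<bar>\<tau> * ?y \<omega>\<bar>\<^sup>2 / 2)"
        using iexp_approx1[of "\<tau> * ?y \<omega>" 1] by (intro mult_left_mono) (auto simp: power2_eq_square)
      also have "\<dots> \<le> \<bar>W \<omega>\<bar> * \<bar>\<tau> * ?y \<omega>\<bar>\<^sup>2"
        by (intro mult_left_mono) auto
      finally show ?thesis
        by (simp add: abs_mult power2_eq_square mult_ac)
    qed
  qed (use int cubic_product(1)[OF Y Y assms] in auto)
  also have "\<dots> \<le> \<tau>\<^sup>2 * (3 * B)"
    using cubic_product(2)[OF Y Y assms] by (simp add: mult_left_mono)
  finally show ?thesis .
qed

lemma \<phi>_increment:
  "norm (\<phi> \<tau> (Suc n) - \<phi> \<tau> n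
      - \<i> * \<tau> * expectation (\<lambda>\<omega>. wave \<tau> n \<omega> * complex_of_real (Y (Suc n) \<omega>))
      + complex_of_real (\<tau>\<^sup>2 / 2) * expectation (\<lambda>\<omega>. wave \<tau> n \<omega> * complex_of_real (Y (Suc n) \<omega> * Y (Suc n) \<omega>)))
    \<le> \<bar>\<tau>\<bar> ^ 3 * (3 * B)"
proof -
  let ?y = "Y (Suc n)"
  have Y: "cubic ?y"
    by (rule cubic_Y) simp
  let ?d = "\<lambda>\<omega>. wave \<tau> (Suc n) \<omega> - wave \<tau> n \<omega> - \<i> * \<tau> * (wave \<tau> n \<omega> * complex_of_real (?y \<omega>))
      + complex_of_real (\<tau>\<^sup>2 / 2) * (wave \<tau> n \<omega> * complex_of_real (?y \<omega> * ?y \<omega>))"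
  have int: "integrable M (\<lambda>\<omega>. wave \<tau> n \<omega> * complex_of_real (?y \<omega>))"
    "integrable M (\<lambda>\<omega>. wave \<tau> n \<omega> * complex_of_real (?y \<omega> * ?y \<omega>))"
    by (intro integrable_wave_mult integrable_Y integrable_YY; simp)+
  note int = int integrable_wave[of \<tau> n] integrable_wave[of \<tau> "Suc n"]
  have eq: "\<phi> \<tau> (Suc n) - \<phi> \<tau> n
      - \<i> * \<tau> * expectation (\<lambda>\<omega>. wave \<tau> n \<omega> * complex_of_real (?y \<omega>))
      + complex_of_real (\<tau>\<^sup>2 / 2) * expectation (\<lambda>\<omega>. wave \<tau> n \<omega> * complex_of_real (?y \<omega> * ?y \<omega>)) = expectation ?d"
    unfolding \<phi>_def using int by (simp del: of_real_mult of_real_divide of_real_power)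
  have "norm (expectation ?d) \<le> expectation (\<lambda>\<omega>. \<bar>\<tau>\<bar> ^ 3 * \<bar>?y \<omega> * ?y \<omega> * ?y \<omega>\<bar>)"
  proof (rule integral_norm_le_integral)
    show "norm (?d \<omega>) \<le> \<bar>\<tau>\<bar> ^ 3 * \<bar>?y \<omega> * ?y \<omega> * ?y \<omega>\<bar>" for \<omega>
    proof -
      let ?z = "\<tau> * ?y \<omega>"
      have taylor: "(\<Sum>k\<le>2. (\<i> * complex_of_real ?z) ^ k / fact k) = 1 + \<i> * ?z - ?z\<^sup>2 / 2"
        by (simp add: eval_nat_numeral power_mult_distrib mult_ac)
      have "norm (iexp ?z - (1 + \<i> * ?z - ?z\<^sup>2 / 2)) \<le> \<bar>?z\<bar> ^ 3 / 6"
        using iexp_approx1[of ?z 2] unfolding taylor by (simp add: eval_nat_numeral)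
      then have remainder: "norm (iexp ?z - (1 + \<i> * ?z - ?z\<^sup>2 / 2)) \<le> \<bar>?z\<bar> ^ 3"
        by (rule order_trans) simp
      have "?d \<omega> = wave \<tau> n \<omega> * (iexp ?z - (1 + \<i> * ?z - ?z\<^sup>2 / 2))"
        by (simp add: wave_Suc algebra_simps power2_eq_square)
      also have "norm \<dots> = norm (iexp ?z - (1 + \<i> * ?z - ?z\<^sup>2 / 2))"
        by (simp add: norm_mult)
      also note remainder
      finally show ?thesis
        by (simp add: abs_mult power3_eq_cube mult_ac)
    qed
  qed (use int cubic_product(1)[OF Y Y Y] in auto)
  also have "\<dots> \<le> \<bar>\<tau>\<bar> ^ 3 * (3 * B)"
    using cubic_product(2)[OF Y Y Y] by (simp add: mult_left_mono)
  finally show ?thesis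
    unfolding eq .
qed

text \<open>
  The error in the replacement of \<open>Y (n - j) * Y n\<close> by the constant \<open>\<gamma> j\<close>, for \<open>j \<le> g\<close>: the first
  summand is the cost of moving the wave back by \<open>(c + 1) * g\<close> steps and forth again, the second that
  of decoupling.
\<close>
definition pair_error :: "real \<Rightarrow> nat \<Rightarrow> real" where
  "pair_error \<tau> g = \<bar>\<tau>\<bar> * real ((c + 1) * g) * (3 * B * (1 + 3 * B)) + r g"

text \<open>
  The wave is moved back from time \<open>n - j - 1\<close> to \<open>m = n - (c + 1) * g\<close>. The distance from \<open>m\<close> to
  \<open>n - j\<close> is at least \<open>c * g\<close>, so the product decouples, and it is at least \<open>g\<close>, so the error is at
  most \<open>r g\<close>.
\<close>
lemma wave_pair:
  assumes g: "1 \<le> g" "j \<le> g" and n: "(c + 1) * g \<le> n"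
  shows "norm (expectation (\<lambda>\<omega>. wave \<tau> (n - j - 1) \<omega> * complex_of_real (Y (n - j) \<omega> * Y n \<omega>))
      - \<gamma> j * \<phi> \<tau> (n - 1)) \<le> pair_error \<tau> g"
proof -
  define G where "G = (c + 1) * g"
  define m where "m = n - G"
  define k where "k = G - j"
  have "1 * g \<le> c * g" "c * j \<le> c * g" "G = c * g + g"
    using c g unfolding G_def by (auto intro: mult_le_mono)
  then have k: "g \<le> k" "c * j \<le> k" and G: "j + 1 \<le> G" "G \<le> n"
    using g n unfolding k_def G_def[symmetric] by linarith+
  have idx: "m + k = n - j" "m + k + j = n" "m \<le> n - j - 1" "m \<le> n - 1"
    "n - j - 1 - m \<le> G" "n - 1 - m \<le> G"
    using G unfolding m_def k_def by auto
  let ?E = "\<lambda>p. expectation (\<lambda>\<omega>. wave \<tau> p \<omega> * complex_of_real (Y (n - j) \<omega> * Y n \<omega>))"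
  have "norm (?E (n - j - 1) - ?E m) \<le> \<bar>\<tau>\<bar> * real (n - j - 1 - m) * (3 * B)"
    using G g by (intro wave_decouple cubic_Y idx) auto
  also have "\<dots> \<le> \<bar>\<tau>\<bar> * real G * (3 * B)"
    using B idx by (intro mult_right_mono mult_left_mono) auto
  finally have 1: "norm (?E (n - j - 1) - ?E m) \<le> \<bar>\<tau>\<bar> * real G * (3 * B)" .
  have 2: "norm (?E m - \<gamma> j * \<phi> \<tau> m) \<le> r g"
    using wave_cov[of k j \<tau> m] k g rate_mono[of g k] unfolding idx(2) unfolding idx(1) by simp
  have "norm (\<phi> \<tau> (n - 1) - \<phi> \<tau> m) \<le> \<bar>\<tau>\<bar> * real (n - 1 - m) * (3 * B)"
    by (rule \<phi>_decouple) (rule idx)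
  also have "\<dots> \<le> \<bar>\<tau>\<bar> * real G * (3 * B)"
    using B idx by (intro mult_right_mono mult_left_mono) auto
  finally have "norm (\<gamma> j * (\<phi> \<tau> m - \<phi> \<tau> (n - 1))) \<le> 3 * B * (\<bar>\<tau>\<bar> * real G * (3 * B))"
    using cov_le[of j] B unfolding norm_mult norm_of_real
    by (intro mult_mono) (auto simp: norm_minus_commute)
  then have 3: "norm (\<gamma> j * \<phi> \<tau> m - \<gamma> j * \<phi> \<tau> (n - 1)) \<le> 3 * B * (\<bar>\<tau>\<bar> * real G * (3 * B))"
    by (simp add: algebra_simps)
  have "?E (n - j - 1) - \<gamma> j * \<phi> \<tau> (n - 1)
      = (?E (n - j - 1) - ?E m) + (?E m - \<gamma> j * \<phi> \<tau> m) + (\<gamma> j * \<phi> \<tau> m - \<gamma> j * \<phi> \<tau> (n - 1))"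
    by simp
  also have "norm \<dots> \<le> \<bar>\<tau>\<bar> * real G * (3 * B) + r g + 3 * B * (\<bar>\<tau>\<bar> * real G * (3 * B))"
    by (intro norm_triangle_mono 1 2 3)
  also have "\<dots> = pair_error \<tau> g"
    unfolding pair_error_def G_def by (simp add: algebra_simps)
  finally show ?thesis .
qed

text \<open>
  The summands \<open>Y (n - 1), \<dots>, Y (n - g)\<close> are removed from the wave one at a time.
\<close>
lemma wave_single:
  assumes g: "1 \<le> g" and n: "(c + 1) * g \<le> n"
  shows "norm (expectation (\<lambda>\<omega>. wave \<tau> (n - 1) \<omega> * complex_of_real (Y n \<omega>))
      - \<i> * \<tau> * complex_of_real (\<Sum>j<g. \<gamma> (Suc j)) * \<phi> \<tau> (n - 1))
    \<le> r g + real g * (\<tau>\<^sup>2 * (3 * B) + \<bar>\<tau>\<bar> * pair_error \<tau> g)"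
proof -
  define f where "f j = expectation (\<lambda>\<omega>. wave \<tau> (n - 1 - j) \<omega> * complex_of_real (Y n \<omega>))" for j
  have "1 * g \<le> c * g"
    using c by (rule mult_le_mono1)
  then have gn: "g + 1 \<le> n"
    using n g unfolding distrib_right by linarith
  have step: "norm (f j - f (Suc j) - \<i> * \<tau> * (\<gamma> (Suc j) * \<phi> \<tau> (n - 1)))
      \<le> \<tau>\<^sup>2 * (3 * B) + \<bar>\<tau>\<bar> * pair_error \<tau> g" if j: "j < g" for j
  proof -
    let ?p = "n - 1 - Suc j"
    have p: "Suc ?p = n - 1 - j" "Suc ?p = n - Suc j" "?p = n - Suc j - 1"
      using j gn by auto
    let ?E = "expectation (\<lambda>\<omega>. wave \<tau> ?p \<omega> * complex_of_real (Y (n - Suc j) \<omega> * Y n \<omega>))"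
    have 1: "norm (f j - f (Suc j) - \<i> * \<tau> * ?E) \<le> \<tau>\<^sup>2 * (3 * B)"
      using wave_increment[OF cubic_Y[of n], of \<tau> ?p] gn unfolding f_def p(1) p(1)[unfolded p(2)] by simp
    have "norm (?E - \<gamma> (Suc j) * \<phi> \<tau> (n - 1)) \<le> pair_error \<tau> g"
      using wave_pair[of g "Suc j" n \<tau>] g j n unfolding p(3) by simp
    then have 2: "norm (\<i> * \<tau> * (?E - \<gamma> (Suc j) * \<phi> \<tau> (n - 1))) \<le> \<bar>\<tau>\<bar> * pair_error \<tau> g"
      by (simp add: norm_mult mult_left_mono)
    have split: "f j - f (Suc j) - \<i> * \<tau> * (\<gamma> (Suc j) * \<phi> \<tau> (n - 1))
        = (f j - f (Suc j) - \<i> * \<tau> * ?E) + \<i> * \<tau> * (?E - \<gamma> (Suc j) * \<phi> \<tau> (n - 1))"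
      by (simp add: algebra_simps)
    show ?thesis
      unfolding split by (intro norm_triangle_mono 1 2)
  qed
  have "norm (f g) \<le> r (Suc g)"
    using wave_mean[of "Suc g" \<tau> "n - 1 - g"] gn unfolding f_def by simp
  then have far: "norm (f g) \<le> r g"
    using rate_mono[of g "Suc g"] g by simp
  have "f 0 - \<i> * \<tau> * complex_of_real (\<Sum>j<g. \<gamma> (Suc j)) * \<phi> \<tau> (n - 1)
      = f g + (\<Sum>j<g. f j - f (Suc j) - \<i> * \<tau> * (\<gamma> (Suc j) * \<phi> \<tau> (n - 1)))"
    using sum_lessThan_telescope'[of f g] by (simp add: sum_subtractf sum_distrib_left sum_distrib_right mult_ac)
  also have "norm \<dots> \<le> r g + (\<Sum>j<g. \<tau>\<^sup>2 * (3 * B) + \<bar>\<tau>\<bar> * pair_error \<tau> g)"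
    by (intro norm_triangle_mono far sum_norm_le) (use step in auto)
  finally show ?thesis
    unfolding f_def by simp
qed

lemma \<phi>_recursion:
  assumes g: "1 \<le> g" and n: "(c + 1) * g \<le> n"
  shows "norm (\<phi> \<tau> n - complex_of_real (1 - \<tau>\<^sup>2 * (\<gamma> 0 / 2 + (\<Sum>j<g. \<gamma> (Suc j)))) * \<phi> \<tau> (n - 1))
    \<le> \<bar>\<tau>\<bar> ^ 3 * (3 * B) + \<bar>\<tau>\<bar> * (r g + real g * (\<tau>\<^sup>2 * (3 * B) + \<bar>\<tau>\<bar> * pair_error \<tau> g))
      + \<tau>\<^sup>2 * pair_error \<tau> g"
proof -
  have "1 \<le> n"
    using g n c by (cases n) auto
  then have Sn: "Suc (n - 1) = n"
    by simp
  let ?A = "expectation (\<lambda>\<omega>. wave \<tau> (n - 1) \<omega> * complex_of_real (Y n \<omega>))"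
  let ?Q = "expectation (\<lambda>\<omega>. wave \<tau> (n - 1) \<omega> * complex_of_real (Y n \<omega> * Y n \<omega>))"
  let ?s = "complex_of_real (\<Sum>j<g. \<gamma> (Suc j))"
  let ?p = "\<phi> \<tau> (n - 1)"
  have 1: "norm (\<phi> \<tau> n - ?p - \<i> * \<tau> * ?A + complex_of_real (\<tau>\<^sup>2 / 2) * ?Q) \<le> \<bar>\<tau>\<bar> ^ 3 * (3 * B)"
    using \<phi>_increment[of \<tau> "n - 1"] unfolding Sn .
  have 2: "norm (\<i> * \<tau> * (?A - \<i> * \<tau> * ?s * ?p))
      \<le> \<bar>\<tau>\<bar> * (r g + real g * (\<tau>\<^sup>2 * (3 * B) + \<bar>\<tau>\<bar> * pair_error \<tau> g))"
    using wave_single[OF assms, of \<tau>] unfolding norm_mult[of "\<i> * \<tau>"] by (intro mult_mono) (auto simp: norm_mult)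
  have "norm (?Q - \<gamma> 0 * ?p) \<le> pair_error \<tau> g"
    using wave_pair[of g 0 n \<tau>] g n by simp
  then have "norm (- complex_of_real (\<tau>\<^sup>2 / 2) * (?Q - \<gamma> 0 * ?p)) \<le> (\<tau>\<^sup>2 / 2) * pair_error \<tau> g"
    unfolding norm_mult by (intro mult_mono) (auto simp: norm_divide norm_power)
  moreover have "(\<tau>\<^sup>2 / 2) * pair_error \<tau> g \<le> \<tau>\<^sup>2 * pair_error \<tau> g"
    using B rate_nonneg[OF g] unfolding pair_error_def by (intro mult_right_mono) auto
  ultimately have 3: "norm (- complex_of_real (\<tau>\<^sup>2 / 2) * (?Q - \<gamma> 0 * ?p)) \<le> \<tau>\<^sup>2 * pair_error \<tau> g"
    by linarith
  have split: "\<phi> \<tau> n - complex_of_real (1 - \<tau>\<^sup>2 * (\<gamma> 0 / 2 + (\<Sum>j<g. \<gamma> (Suc j)))) * ?p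
      = (\<phi> \<tau> n - ?p - \<i> * \<tau> * ?A + complex_of_real (\<tau>\<^sup>2 / 2) * ?Q)
        + \<i> * \<tau> * (?A - \<i> * \<tau> * ?s * ?p) + - complex_of_real (\<tau>\<^sup>2 / 2) * (?Q - \<gamma> 0 * ?p)"
    by (simp add: algebra_simps power2_eq_square)
  show ?thesis
    unfolding split by (intro norm_triangle_mono 1 2 3)
qed

section \<open>The limit of the characteristic functions\<close>

text \<open>
  The sum of the covariances \<open>\<gamma> \<bar>j\<bar>\<close> over all integers \<open>j\<close>.
\<close>
definition asymptotic_variance :: real where
  "asymptotic_variance = \<gamma> 0 + 2 * (\<Sum>j. \<gamma> (Suc j))"

text \<open>
  The error in the truncation of the covariance series after \<open>g\<close> terms.
\<close>
definition cov_tail :: "nat \<Rightarrow> real" where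
  "cov_tail g = \<bar>(\<Sum>j<g. \<gamma> (Suc j)) - (\<Sum>j. \<gamma> (Suc j))\<bar>"

lemma cov_tail_tendsto: "cov_tail \<longlonglongrightarrow> 0"
proof -
  have "(\<lambda>g. \<bar>(\<Sum>j<g. \<gamma> (Suc j)) - (\<Sum>j. \<gamma> (Suc j))\<bar>) \<longlonglongrightarrow> \<bar>0\<bar>"
    using summable_LIMSEQ[OF summable_cov] by (intro tendsto_rabs LIM_zero)
  then show ?thesis
    unfolding cov_tail_def by simp
qed

text \<open>
  The error of one step of the recursion for \<open>\<phi>\<close>, with the full covariance series. With
  fewer than \<open>(c + 1) * g\<close> summands the past is too short for the recursion, and the crude bound
  \<open>start_error\<close> is used.
\<close>
definition step_error :: "real \<Rightarrow> nat \<Rightarrow> real" where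
  "step_error \<tau> g = \<bar>\<tau>\<bar> ^ 3 * (3 * B) + \<bar>\<tau>\<bar> * (r g + real g * (\<tau>\<^sup>2 * (3 * B) + \<bar>\<tau>\<bar> * pair_error \<tau> g))
      + \<tau>\<^sup>2 * pair_error \<tau> g + \<tau>\<^sup>2 * cov_tail g"

definition start_error :: "real \<Rightarrow> real" where
  "start_error \<tau> = \<bar>\<tau>\<bar> * (3 * B) + \<tau>\<^sup>2 * \<bar>asymptotic_variance\<bar>"

lemma step_error_nonneg: "1 \<le> g \<Longrightarrow> 0 \<le> step_error \<tau> g"
  using B rate_nonneg[of g] unfolding step_error_def pair_error_def cov_tail_def
  by (intro add_nonneg_nonneg mult_nonneg_nonneg) auto

lemma start_error_nonneg: "0 \<le> start_error \<tau>"
  using B unfolding start_error_def by auto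

lemma \<phi>_step:
  fixes \<tau> :: real
  assumes g: "1 \<le> g"
  defines "q \<equiv> 1 - \<tau>\<^sup>2 * asymptotic_variance / 2"
  shows "norm (\<phi> \<tau> (Suc n) - complex_of_real q * \<phi> \<tau> n)
    \<le> (if Suc n < (c + 1) * g then start_error \<tau> else step_error \<tau> g)"
proof (cases "Suc n < (c + 1) * g")
  case True
  have 1: "norm (\<phi> \<tau> (Suc n) - \<phi> \<tau> n) \<le> \<bar>\<tau>\<bar> * (3 * B)"
    using \<phi>_decouple[of n "Suc n" \<tau>] by simp
  have "norm (complex_of_real (\<tau>\<^sup>2 * asymptotic_variance / 2) * \<phi> \<tau> n)
      \<le> \<bar>\<tau>\<^sup>2 * asymptotic_variance / 2\<bar> * 1"
    unfolding norm_mult norm_of_real using norm_\<phi>_le by (intro mult_left_mono) auto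
  also have "\<dots> \<le> \<tau>\<^sup>2 * \<bar>asymptotic_variance\<bar>"
    by (simp add: abs_mult)
  finally have 2: "norm (complex_of_real (\<tau>\<^sup>2 * asymptotic_variance / 2) * \<phi> \<tau> n)
      \<le> \<tau>\<^sup>2 * \<bar>asymptotic_variance\<bar>" .
  have split: "\<phi> \<tau> (Suc n) - complex_of_real q * \<phi> \<tau> n
      = (\<phi> \<tau> (Suc n) - \<phi> \<tau> n) + complex_of_real (\<tau>\<^sup>2 * asymptotic_variance / 2) * \<phi> \<tau> n"
    unfolding q_def by (simp add: algebra_simps)
  have "norm (\<phi> \<tau> (Suc n) - complex_of_real q * \<phi> \<tau> n) \<le> start_error \<tau>"
    unfolding split start_error_def by (intro norm_triangle_mono 1 2)
  with True show ?thesis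
    by simp
next
  case False
  let ?q = "1 - \<tau>\<^sup>2 * (\<gamma> 0 / 2 + (\<Sum>j<g. \<gamma> (Suc j)))"
  let ?e = "\<bar>\<tau>\<bar> ^ 3 * (3 * B) + \<bar>\<tau>\<bar> * (r g + real g * (\<tau>\<^sup>2 * (3 * B) + \<bar>\<tau>\<bar> * pair_error \<tau> g))
      + \<tau>\<^sup>2 * pair_error \<tau> g"
  have 1: "norm (\<phi> \<tau> (Suc n) - complex_of_real ?q * \<phi> \<tau> n) \<le> ?e"
    using \<phi>_recursion[OF g, of "Suc n" \<tau>] False by simp
  have "?q - q = - (\<tau>\<^sup>2 * ((\<Sum>j<g. \<gamma> (Suc j)) - (\<Sum>j. \<gamma> (Suc j))))"
    unfolding q_def asymptotic_variance_def by (simp add: algebra_simps)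
  then have "\<bar>?q - q\<bar> = \<tau>\<^sup>2 * cov_tail g"
    unfolding cov_tail_def by (simp add: abs_mult)
  then have "norm (complex_of_real (?q - q) * \<phi> \<tau> n) \<le> \<tau>\<^sup>2 * cov_tail g * 1"
    unfolding norm_mult norm_of_real using norm_\<phi>_le
    by (intro mult_mono) (auto simp: cov_tail_def)
  then have 2: "norm (complex_of_real (?q - q) * \<phi> \<tau> n) \<le> \<tau>\<^sup>2 * cov_tail g"
    by simp
  have split: "\<phi> \<tau> (Suc n) - complex_of_real q * \<phi> \<tau> n
      = (\<phi> \<tau> (Suc n) - complex_of_real ?q * \<phi> \<tau> n) + complex_of_real (?q - q) * \<phi> \<tau> n"
    by (simp add: algebra_simps)
  have "norm (\<phi> \<tau> (Suc n) - complex_of_real q * \<phi> \<tau> n) \<le> step_error \<tau> g"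
    unfolding split step_error_def by (intro norm_triangle_mono 1 2)
  with False show ?thesis
    by simp
qed

lemma \<phi>_geometric:
  fixes \<tau> :: real
  assumes g: "1 \<le> g"
  defines "q \<equiv> 1 - \<tau>\<^sup>2 * asymptotic_variance / 2"
  shows "norm (\<phi> \<tau> N - complex_of_real (q ^ N))
    \<le> exp (real N * (\<tau>\<^sup>2 * \<bar>asymptotic_variance\<bar>))
        * (real ((c + 1) * g) * start_error \<tau> + real N * step_error \<tau> g)"
proof -
  let ?G = "(c + 1) * g"
  let ?e = "\<lambda>n. if Suc n < ?G then start_error \<tau> else step_error \<tau> g"
  have \<phi>0: "\<phi> \<tau> 0 = 1"
    unfolding \<phi>_def wave_def by (simp add: prob_space)
  have "norm (\<phi> \<tau> N - q ^ N * \<phi> \<tau> 0) \<le> max 1 \<bar>q\<bar> ^ N * (\<Sum>n<N. ?e n)"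
    unfolding q_def by (intro perturbed_geometric_recursion \<phi>_step g)
  also have "\<dots> \<le> exp (real N * (\<tau>\<^sup>2 * \<bar>asymptotic_variance\<bar>))
        * (real ?G * start_error \<tau> + real N * step_error \<tau> g)"
  proof (rule mult_mono)
    have "\<bar>q\<bar> \<le> 1 + \<bar>\<tau>\<^sup>2 * asymptotic_variance / 2\<bar>"
      unfolding q_def using abs_triangle_ineq4[of 1 "\<tau>\<^sup>2 * asymptotic_variance / 2"] by simp
    also have "\<dots> \<le> 1 + \<tau>\<^sup>2 * \<bar>asymptotic_variance\<bar>"
      by (simp add: abs_mult)
    also have "\<dots> \<le> exp (\<tau>\<^sup>2 * \<bar>asymptotic_variance\<bar>)"
      by (rule exp_ge_add_one_self)
    finally have "max 1 \<bar>q\<bar> \<le> exp (\<tau>\<^sup>2 * \<bar>asymptotic_variance\<bar>)"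
      by simp
    then show "max 1 \<bar>q\<bar> ^ N \<le> exp (real N * (\<tau>\<^sup>2 * \<bar>asymptotic_variance\<bar>))"
      unfolding exp_of_nat_mult by (intro power_mono) auto
    have "(\<Sum>n<N. ?e n) \<le> (\<Sum>n<N. (if n < ?G then start_error \<tau> else 0) + step_error \<tau> g)"
      using step_error_nonneg[OF g] start_error_nonneg by (intro sum_mono) auto
    also have "\<dots> = real (card ({..<N} \<inter> {..<?G})) * start_error \<tau> + real N * step_error \<tau> g"
      by (simp add: sum.distrib sum.If_cases lessThan_def del: mult_Suc add_Suc)
    also have "\<dots> \<le> real ?G * start_error \<tau> + real N * step_error \<tau> g"
      using card_mono[of "{..<?G}" "{..<N} \<inter> {..<?G}"] start_error_nonneg
      by (intro add_right_mono mult_right_mono of_nat_mono) (simp_all only: card_lessThan finite_lessThan Int_lower2)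
    finally show "(\<Sum>n<N. ?e n) \<le> real ?G * start_error \<tau> + real N * step_error \<tau> g" .
    show "0 \<le> (\<Sum>n<N. ?e n)"
      using step_error_nonneg[OF g] start_error_nonneg by (intro sum_nonneg) auto
  qed simp
  finally show ?thesis
    unfolding \<phi>0 by simp
qed

lemma gap_rate:
  "(\<lambda>N. sqrt (real N) * r (gap N)) \<longlonglongrightarrow> 0"
  "(\<lambda>N. real (gap N) * r (gap N)) \<longlonglongrightarrow> 0"
proof -
  have lim: "(\<lambda>N. real (gap N) ^ 5 * r (gap N)) \<longlonglongrightarrow> 0"
    by (rule filterlim_compose[OF rate_decay gap_asymptotics(1)])
  have gap1: "\<forall>\<^sub>F N in sequentially. 1 \<le> gap N"
    using gap_asymptotics(1) by (simp add: filterlim_at_top)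
  show "(\<lambda>N. sqrt (real N) * r (gap N)) \<longlonglongrightarrow> 0"
  proof (rule Lim_null_comparison)
    show "(\<lambda>N. 2 * (real (gap N) ^ 5 * r (gap N))) \<longlonglongrightarrow> 0"
      using tendsto_mult_left[OF lim, of 2] by simp
    show "\<forall>\<^sub>F N in sequentially. norm (sqrt (real N) * r (gap N)) \<le> 2 * (real (gap N) ^ 5 * r (gap N))"
      using gap1 gap_asymptotics(4)
    proof eventually_elim
      case (elim N)
      then show ?case
        using rate_nonneg[of "gap N"] mult_right_mono[OF elim(2), of "r (gap N)"] by (simp add: abs_mult)
    qed
  qed
  show "(\<lambda>N. real (gap N) * r (gap N)) \<longlonglongrightarrow> 0"
  proof (rule Lim_null_comparison[OF _ lim])
    show "\<forall>\<^sub>F N in sequentially. norm (real (gap N) * r (gap N)) \<le> real (gap N) ^ 5 * r (gap N)"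
      using gap1
    proof eventually_elim
      case (elim N)
      then have "real (gap N) ^ 1 \<le> real (gap N) ^ 5"
        by (intro power_increasing) auto
      then show ?case
        using rate_nonneg[OF elim] mult_right_mono[of "real (gap N)" "real (gap N) ^ 5" "r (gap N)"]
        by (simp add: abs_mult)
    qed
  qed
qed

lemma error_tendsto:
  "(\<lambda>N. real ((c + 1) * gap N) * start_error (t / sqrt (real N))
      + real N * step_error (t / sqrt (real N)) (gap N)) \<longlonglongrightarrow> 0"
proof -
  let ?s = "\<lambda>N. 1 / sqrt (real N)" and ?x = "\<lambda>N. real (gap N) / sqrt (real N)"
    and ?y = "\<lambda>N. (real (gap N))\<^sup>2 / sqrt (real N)"
  let ?K = "real (c + 1) * (3 * B * (1 + 3 * B))"
  let ?R = "\<lambda>N. r (gap N)" and ?\<rho> = "\<lambda>N. sqrt (real N) * r (gap N)"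
    and ?\<eta> = "\<lambda>N. real (gap N) * r (gap N)" and ?\<theta> = "\<lambda>N. cov_tail (gap N)"
  \<comment> \<open>The errors at \<open>\<tau> = t / sqrt N\<close>, written as a combination of null sequences.\<close>
  let ?bound = "\<lambda>N. real (c + 1) * (\<bar>t\<bar> * (3 * B) * ?x N + t\<^sup>2 * \<bar>asymptotic_variance\<bar> * (?s N * ?x N))
    + (\<bar>t\<bar> ^ 3 * (3 * B) * ?s N + \<bar>t\<bar> * ?\<rho> N + \<bar>t\<bar> ^ 3 * (3 * B) * ?x N
      + t\<^sup>2 * (\<bar>t\<bar> * ?K * ?y N + ?\<eta> N) + t\<^sup>2 * (\<bar>t\<bar> * ?K * ?x N + ?R N) + t\<^sup>2 * ?\<theta> N)"
  have s: "?s \<longlonglongrightarrow> 0"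
    by real_asymp
  have R: "?R \<longlonglongrightarrow> 0"
    by (rule filterlim_compose[OF rate_tendsto_0 gap_asymptotics(1)])
  have \<theta>: "?\<theta> \<longlonglongrightarrow> 0"
    by (rule filterlim_compose[OF cov_tail_tendsto gap_asymptotics(1)])
  have "?bound \<longlonglongrightarrow> real (c + 1) * (\<bar>t\<bar> * (3 * B) * 0 + t\<^sup>2 * \<bar>asymptotic_variance\<bar> * (0 * 0))
    + (\<bar>t\<bar> ^ 3 * (3 * B) * 0 + \<bar>t\<bar> * 0 + \<bar>t\<bar> ^ 3 * (3 * B) * 0
      + t\<^sup>2 * (\<bar>t\<bar> * ?K * 0 + 0) + t\<^sup>2 * (\<bar>t\<bar> * ?K * 0 + 0) + t\<^sup>2 * 0)"
    by (intro tendsto_add tendsto_mult tendsto_const s R \<theta> gap_asymptotics(2,3) gap_rate)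
  then have bound: "?bound \<longlonglongrightarrow> 0"
    by simp
  have "?bound N = real ((c + 1) * gap N) * start_error (t / sqrt (real N))
      + real N * step_error (t / sqrt (real N)) (gap N)" if N: "1 \<le> N" for N
  proof -
    define s a where "s = sqrt (real N)" and "a = \<bar>t\<bar>"
    have s: "s \<noteq> 0" "real N = s * s" "\<bar>t / s\<bar> = a / s" "(t / s)\<^sup>2 = (a / s)\<^sup>2"
      using N unfolding s_def a_def by (auto simp: power_divide)
    have a: "\<bar>t\<bar> = a" "t\<^sup>2 = a\<^sup>2"
      unfolding a_def by auto
    have expand: "k * (a / s * b + (a / s)\<^sup>2 * V) * g
        + s * s * ((a / s) ^ 3 * b + a / s * (R + g * ((a / s)\<^sup>2 * b + a / s * (a / s * (k * g) * K + R)))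
          + (a / s)\<^sup>2 * (a / s * (k * g) * K + R) + (a / s)\<^sup>2 * T)
      = k * (a * b * (g / s) + a\<^sup>2 * V * (1 / s * (g / s)))
        + (a ^ 3 * b * (1 / s) + a * (s * R) + a ^ 3 * b * (g / s)
          + a\<^sup>2 * (a * (k * K) * (g\<^sup>2 / s) + g * R) + a\<^sup>2 * (a * (k * K) * (g / s) + R) + a\<^sup>2 * T)"
      for k b V g R K T :: real
      using s(1) by (simp add: field_simps power2_eq_square power3_eq_cube)
    show ?thesis
      unfolding s_def[symmetric]
      unfolding start_error_def step_error_def pair_error_def s(2-4) a of_nat_mult
      using expand[of "real (c + 1)" "3 * B" "\<bar>asymptotic_variance\<bar>" "real (gap N)" "r (gap N)"
          "3 * B * (1 + 3 * B)" "cov_tail (gap N)"] by (simp only: mult_ac)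
  qed
  then have "\<forall>\<^sub>F N in sequentially. ?bound N = real ((c + 1) * gap N) * start_error (t / sqrt (real N))
      + real N * step_error (t / sqrt (real N)) (gap N)"
    by (rule eventually_sequentiallyI)
  then show ?thesis
    by (rule Lim_transform_eventually[OF bound])
qed

lemma \<phi>_tendsto:
  "(\<lambda>N. \<phi> (t / sqrt (real N)) N) \<longlonglongrightarrow> complex_of_real (exp (- (t\<^sup>2 * asymptotic_variance / 2)))"
proof -
  let ?\<tau> = "\<lambda>N. t / sqrt (real N)"
  let ?V = "asymptotic_variance"
  let ?q = "\<lambda>N. 1 - (?\<tau> N)\<^sup>2 * ?V / 2"
  let ?err = "\<lambda>N. real ((c + 1) * gap N) * start_error (?\<tau> N) + real N * step_error (?\<tau> N) (gap N)"
  have "(\<lambda>N. \<phi> (?\<tau> N) N - complex_of_real (?q N ^ N)) \<longlonglongrightarrow> 0"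
  proof (rule Lim_null_comparison)
    show "(\<lambda>N. exp (t\<^sup>2 * \<bar>?V\<bar>) * ?err N) \<longlonglongrightarrow> 0"
      using tendsto_mult_left[OF error_tendsto, of "exp (t\<^sup>2 * \<bar>?V\<bar>)" t] by simp
    have "\<forall>\<^sub>F N in sequentially. 1 \<le> gap N"
      using gap_asymptotics(1) by (simp add: filterlim_at_top)
    then show "\<forall>\<^sub>F N in sequentially. norm (\<phi> (?\<tau> N) N - complex_of_real (?q N ^ N)) \<le> exp (t\<^sup>2 * \<bar>?V\<bar>) * ?err N"
      using eventually_ge_at_top[of 1]
    proof eventually_elim
      case (elim N)
      have eq: "real N * ((?\<tau> N)\<^sup>2 * \<bar>?V\<bar>) = t\<^sup>2 * \<bar>?V\<bar>"
        using elim by (simp add: power_divide)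
      show ?case
        using \<phi>_geometric[OF elim(1), of "?\<tau> N" N] unfolding eq .
    qed
  qed
  moreover have "(\<lambda>N. complex_of_real (?q N ^ N)) \<longlonglongrightarrow> complex_of_real (exp (- (t\<^sup>2 * ?V / 2)))"
  proof (rule tendsto_of_real)
    have "?q N = 1 + (- (t\<^sup>2 * ?V / 2)) / real N" for N
      by (simp add: power_divide)
    then show "(\<lambda>N. ?q N ^ N) \<longlonglongrightarrow> exp (- (t\<^sup>2 * ?V / 2))"
      using tendsto_exp_limit_sequentially[of "- (t\<^sup>2 * ?V / 2)"] by presburger
  qed
  ultimately show ?thesis
    using tendsto_add by fastforce
qed

text \<open>
  Characteristic functions are bounded by \<open>1\<close>, and so is their limit at \<open>t = 1\<close>.
\<close>
lemma asymptotic_variance_nonneg: "0 \<le> asymptotic_variance"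
proof -
  have "(\<lambda>N. norm (\<phi> (1 / sqrt (real N)) N)) \<longlonglongrightarrow> norm (complex_of_real (exp (- (1\<^sup>2 * asymptotic_variance / 2))))"
    by (intro tendsto_norm \<phi>_tendsto)
  then have "norm (complex_of_real (exp (- (1\<^sup>2 * asymptotic_variance / 2)))) \<le> 1"
    by (rule tendsto_upperbound) (auto simp: norm_\<phi>_le)
  then show ?thesis
    by simp
qed

lemma char_normalized_sum:
  "char (distr M borel (\<lambda>\<omega>. (\<Sum>i=1..n. Y i \<omega>) / sqrt (real n))) t = \<phi> (t / sqrt (real n)) n"
proof -
  have "(\<lambda>\<omega>. (\<Sum>i=1..n. Y i \<omega>) / sqrt (real n)) \<in> borel_measurable M"
    using Y_measurable by (intro borel_measurable_divide borel_measurable_sum) auto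
  then show ?thesis
    unfolding char_def \<phi>_def wave_def by (subst integral_distr) auto
qed

end

text \<open>
  The normal law is the image of the standard normal law under scaling, also when \<open>s = 0\<close>.
\<close>
lemma
  assumes "0 \<le> s"
  shows real_distribution_normal_law: "real_distribution (normal_law 0 s)"
    and char_normal_law: "char (normal_law 0 s) t = complex_of_real (exp (- (t\<^sup>2 * s\<^sup>2 / 2)))"
proof -
  interpret std: real_distribution std_normal_distribution
    by (rule real_dist_normal_dist)
  have "normal_law 0 s = distr std_normal_distribution borel (\<lambda>x. s * x)"
  proof (cases "s = 0")
    case True
    then show ?thesis
      by (simp add: normal_law_def std.distr_const)
  next
    case False
    have "distributed std_normal_distribution lborel (\<lambda>x. x) std_normal_density"
      unfolding distributed_def by (auto simp: distr_id2)
    from std.normal_density_affine[OF this, of s 0] False assms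
    have "distr std_normal_distribution lborel (\<lambda>x. s * x) = density lborel (normal_density 0 s)"
      unfolding distributed_def by simp
    moreover have "distr std_normal_distribution lborel (\<lambda>x. s * x) = distr std_normal_distribution borel (\<lambda>x. s * x)"
      by (rule distr_cong) auto
    ultimately show ?thesis
      using False by (simp add: normal_law_def)
  qed
  then show "real_distribution (normal_law 0 s)"
    and "char (normal_law 0 s) t = complex_of_real (exp (- (t\<^sup>2 * s\<^sup>2 / 2)))"
    using char_std_normal_distribution[THEN fun_cong, of "t * s"]
    by (auto simp: char_def integral_distr power_mult_distrib mult_ac)
qed

theorem (in weakly_dependent_sequence) central_limit:
  "weak_conv_m (\<lambda>n. distr M borel (\<lambda>\<omega>. (\<Sum>i=1..n. Y i \<omega>) / sqrt (real n)))
     (normal_law 0 (sqrt asymptotic_variance))"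
proof (rule levy_continuity)
  show "real_distribution (distr M borel (\<lambda>\<omega>. (\<Sum>i=1..n. Y i \<omega>) / sqrt (real n)))" for n
    using Y_measurable by (intro real_distribution_distr borel_measurable_divide borel_measurable_sum) auto
  show "real_distribution (normal_law 0 (sqrt asymptotic_variance))"
    using asymptotic_variance_nonneg by (intro real_distribution_normal_law) simp
  show "(\<lambda>n. char (distr M borel (\<lambda>\<omega>. (\<Sum>i=1..n. Y i \<omega>) / sqrt (real n))) t)
      \<longlonglongrightarrow> char (normal_law 0 (sqrt asymptotic_variance)) t" for t
    using \<phi>_tendsto[of t] asymptotic_variance_nonneg unfolding char_normalized_sum
    by (simp add: char_normal_law)
qed

section \<open>Application to functionals of a Markov process\<close>

lemma integrable_exp_abs_cubic_growth:
  fixes f :: "real \<Rightarrow> real"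
  assumes [measurable]: "f \<in> borel_measurable borel"
    and growth: "\<And>y. \<bar>f y\<bar> \<le> K * (1 + \<bar>y\<bar> ^ 3)"
  shows "integrable lborel (\<lambda>y. exp (- \<bar>y\<bar>) * f y)"
proof -
  have half: "integrable lborel (\<lambda>y::real. y ^ p * exp (- y) * indicator {0..} y)" for p
  proof (rule integrableI_nonneg)
    have "(\<integral>\<^sup>+ y. ennreal (y ^ p * exp (- y) * indicator {0..} y) \<partial>lborel)
        = (\<integral>\<^sup>+ y. ennreal (y ^ p * exp (- y)) * indicator {0 ..} y \<partial>lborel)"
      by (intro nn_integral_cong) (auto split: split_indicator)
    then show "(\<integral>\<^sup>+ y. ennreal (y ^ p * exp (- y) * indicator {0..} y) \<partial>lborel) < \<infinity>"
      unfolding nn_intergal_power_times_exp_Ici by simp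
  qed (auto split: split_indicator)
  have two: "integrable lborel (\<lambda>y :: real. y ^ p * exp (- y) * indicator {0..} y
      + (- y) ^ p * exp (- (- y)) * indicator {0..} (- y))" for p
    using half[of p] lborel_integrable_real_affine[OF half[of p], of "- 1" 0]
    by (intro Bochner_Integration.integrable_add) auto
  let ?h = "\<lambda>p (y :: real). y ^ p * exp (- y) * indicator {0..} y + (- y) ^ p * exp (- (- y)) * indicator {0..} (- y)"
  have "integrable lborel (\<lambda>y. K * (?h 0 y + ?h 3 y))"
    by (intro integrable_mult_right Bochner_Integration.integrable_add two)
  then show ?thesis
  proof (rule Bochner_Integration.integrable_bound)
    have K: "0 \<le> K"
      using growth[of 0] by simp
    have "\<bar>exp (- \<bar>y\<bar>) * f y\<bar> \<le> K * (?h 0 y + ?h 3 y)" for y :: real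
    proof -
      have "\<bar>exp (- \<bar>y\<bar>) * f y\<bar> \<le> exp (- \<bar>y\<bar>) * (K * (1 + \<bar>y\<bar> ^ 3))"
        using growth[of y] by (simp add: abs_mult)
      also have "\<dots> = K * (exp (- \<bar>y\<bar>) * 1 + \<bar>y\<bar> ^ 3 * exp (- \<bar>y\<bar>))"
        by (simp add: algebra_simps)
      also have "\<dots> \<le> K * (?h 0 y + ?h 3 y)"
        using K by (intro mult_left_mono add_mono) (auto split: split_indicator)
      finally show ?thesis .
    qed
    then show "AE y in lborel. norm (exp (- \<bar>y\<bar>) * f y) \<le> norm (K * (?h 0 y + ?h 3 y))"
      by (intro AE_I2) (auto intro: order_trans[OF _ abs_ge_self])
  qed simp
qed

lemma subalgebra_natural_filtration:
  assumes "\<And>u. 0 \<le> u \<Longrightarrow> Z u \<in> \<Omega> \<rightarrow>\<^sub>M S" and "s \<le> t"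
  shows "subalgebra (natural_filtration \<Omega> S Z t) (natural_filtration \<Omega> S Z s)"
    and "sets M = sets \<Omega> \<Longrightarrow> subalgebra M (natural_filtration \<Omega> S Z t)"
proof -
  let ?A = "\<lambda>t. {Z u -` A \<inter> space \<Omega> | u A. u \<in> {0..t} \<and> A \<in> sets S}"
  have Pow: "?A t \<subseteq> Pow (space \<Omega>)" for t
    by auto
  have sets: "sets (natural_filtration \<Omega> S Z t) = sigma_sets (space \<Omega>) (?A t)"
    and space: "space (natural_filtration \<Omega> S Z t) = space \<Omega>" for t
    unfolding natural_filtration_def by (simp_all only: sets_measure_of[OF Pow] space_measure_of[OF Pow])
  have "sigma_sets (space \<Omega>) (?A s) \<subseteq> sigma_sets (space \<Omega>) (?A t)"
    using assms(2) by (intro sigma_sets_mono') force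
  then show "subalgebra (natural_filtration \<Omega> S Z t) (natural_filtration \<Omega> S Z s)"
    unfolding subalgebra_def sets space by simp
  have "?A t \<subseteq> sets \<Omega>"
    using assms(1) by (auto intro: measurable_sets)
  then have "sigma_sets (space \<Omega>) (?A t) \<subseteq> sets \<Omega>"
    by (rule sets.sigma_sets_subset)
  then show "subalgebra M (natural_filtration \<Omega> S Z t)" if "sets M = sets \<Omega>"
    unfolding subalgebra_def sets space using that sets_eq_imp_space_eq[OF that] by simp
qed

lemma le_one_plus_cube:
  fixes y :: real
  assumes "0 \<le> y"
  shows "y \<le> 1 + y ^ 3" "y ^ 2 \<le> 1 + y ^ 3"
proof -
  have "y \<le> 1 + y ^ 3 \<and> y ^ 2 \<le> 1 + y ^ 3"
  proof (cases "y \<le> 1")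
    case True
    then show ?thesis
      using assms power_le_one[OF assms True, of 2] by (auto intro: add_increasing2)
  next
    case False
    then show ?thesis
      using power_increasing[of 1 3 y] power_increasing[of 2 3 y] by (simp only: power_one_right) linarith
  qed
  then show "y \<le> 1 + y ^ 3" "y ^ 2 \<le> 1 + y ^ 3"
    by auto
qed

theorem theoremA1:
  fixes S :: "'s measure"
    and \<Omega> :: "'w measure"
    and P :: "'s \<Rightarrow> 'w measure"
    and Z :: "real \<Rightarrow> 'w \<Rightarrow> 's"
    and X :: "nat \<Rightarrow> 'w \<Rightarrow> real"
    and \<Phi> :: "nat \<Rightarrow> real"
    and C c v :: real
    and \<nu> :: "'s measure"
  assumes markov: "markov_process S \<Omega> P Z"
    and H1a: "(SUP x\<in>space S. SUP n\<in>{1..}. \<integral>\<^sup>+ \<omega>. ennreal ((X n \<omega>)\<^sup>2) \<partial>P x) < \<infinity>"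
    and H1b: "\<And>i. i \<ge> 1 \<Longrightarrow> X i \<in> borel_measurable (natural_filtration \<Omega> S Z (real i))"
    and H1c: "\<And>k n f x. k \<ge> 1 \<Longrightarrow> n \<ge> 1 \<Longrightarrow> f \<in> borel_measurable (borel_pow n) \<Longrightarrow>
        (\<And>y. y \<in> space S \<Longrightarrow> integrable (P y) (\<lambda>\<omega>. f (block X 1 n \<omega>))) \<Longrightarrow>
        bdd_above ((\<lambda>y. \<integral>\<omega>. f (block X 1 n \<omega>) \<partial>P y) ` space S) \<Longrightarrow>
        x \<in> space S \<Longrightarrow>
        AE \<omega> in P x.
          real_cond_exp (P x) (natural_filtration \<Omega> S Z (real (k - 1)))
            (\<lambda>\<omega>'. f (block X k n \<omega>')) \<omega>
          = (\<integral>\<omega>'. f (block X 1 n \<omega>') \<partial>P (Z (real (k - 1)) \<omega>))"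
    and decreasing: "antimono_on {1..} \<Phi>"
    and C: "C \<ge> 1"
    and c: "c \<ge> 1"
    and \<nu>: "prob_space \<nu>" "sets \<nu> = sets S"
    and H2a: "(\<lambda>n. exp ((ln (real n))\<^sup>2) * \<Phi> n) \<longlonglongrightarrow> 0"
    and H2b: "\<And>i. i \<ge> 1 \<Longrightarrow> (\<integral>\<omega>. X i \<omega> \<partial>(\<nu> \<bind> P)) = v"
    and H2c: "\<And>f :: real \<Rightarrow> real. f \<in> borel_measurable borel \<Longrightarrow>
        integrable lborel (\<lambda>y. exp (- \<bar>y\<bar>) * f y) \<Longrightarrow>
        integrable (\<nu> \<bind> P) (\<lambda>\<omega>. f (X 1 \<omega>)) \<and>
        (\<exists>Cf. \<forall>k\<ge>1. \<forall>x\<in>space S.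
           integrable (P x) (\<lambda>\<omega>. f (X k \<omega>)) \<and>
           \<bar>(\<integral>\<omega>. f (X k \<omega>) \<partial>P x) - (\<integral>\<omega>. f (X 1 \<omega>) \<partial>(\<nu> \<bind> P))\<bar> \<le> Cf * \<Phi> k)"
    and H2d: "\<And>k n x. k \<ge> 1 \<Longrightarrow> n \<ge> 1 \<Longrightarrow> real k \<ge> c * real n \<Longrightarrow> x \<in> space S \<Longrightarrow>
        \<bar>(\<integral>\<omega>. X k \<omega> * X (k + n) \<omega> \<partial>P x) - (\<integral>\<omega>. X 1 \<omega> * X (n + 1) \<omega> \<partial>(\<nu> \<bind> P))\<bar> \<le> C * \<Phi> k"
    and H2e: "\<And>k n F x. k \<ge> 1 \<Longrightarrow> n \<ge> 1 \<Longrightarrow> real k > c * real n \<Longrightarrow>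
        F \<in> borel_measurable (borel_pow n) \<Longrightarrow> bounded (F ` space (borel_pow n)) \<Longrightarrow>
        x \<in> space S \<Longrightarrow>
        \<bar>(\<integral>\<omega>. F (block X k n \<omega>) \<partial>P x) - (\<integral>\<omega>. F (block X 1 n \<omega>) \<partial>(\<nu> \<bind> P))\<bar>
          \<le> C * (SUP y\<in>space (borel_pow n). \<bar>F y\<bar>) * \<Phi> k"
  shows "\<exists>s\<ge>0. \<forall>x\<in>space S.
           weak_conv_m
             (\<lambda>n. distr (P x) borel (\<lambda>\<omega>. ((\<Sum>i=1..n. X i \<omega>) - v * real n) / sqrt (real n)))
             (normal_law 0 s)"
proof -
  interpret markov_process S \<Omega> P Z
    by (rule markov)
  define Y where "Y i \<omega> = X i \<omega> - v" for i \<omega>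
  define F where "F m = natural_filtration \<Omega> S Z (real m)" for m

  have P: "prob_space (P x)" "sets (P x) = sets \<Omega>" "space (P x) = space \<Omega>" if "x \<in> space S" for x
    using measurable_space[OF kernel that] sets_eq_imp_space_eq
    by (auto simp: space_prob_algebra)
  have F: "subalgebra (P x) (F m)" if "x \<in> space S" for x m
    unfolding F_def using subalgebra_natural_filtration(2)[OF process_measurable order_refl P(2)[OF that]] .
  have adapted: "Y i \<in> borel_measurable (F m)" if "1 \<le> i" "i \<le> m" for i m
    unfolding Y_def F_def using that
    by (intro borel_measurable_diff borel_measurable_const
        measurable_from_subalg[OF subalgebra_natural_filtration(1)[OF process_measurable] H1b]) auto
  have YP: "Y i \<in> borel_measurable (P x)" if "1 \<le> i" "x \<in> space S" for i x
    using measurable_from_subalg[OF F[OF that(2)] adapted[OF that(1) order_refl]] .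

  have \<Phi>_mono: "\<Phi> l \<le> \<Phi> k" if "1 \<le> k" "k \<le> l" for k l
    using decreasing that by (auto simp: monotone_on_def)
  have exp_ge_1: "1 \<le> exp ((ln (real n))\<^sup>2)" for n
    by simp
  have \<Phi>_lim: "\<Phi> \<longlonglongrightarrow> 0"
    using mult_right_mono[OF exp_ge_1 abs_ge_zero]
    by (intro Lim_null_comparison[OF _ tendsto_rabs_zero[OF H2a]]) (auto simp: abs_mult)
  have \<Phi>_nonneg: "0 \<le> \<Phi> k" if "1 \<le> k" for k
    using \<Phi>_mono[OF that] by (intro tendsto_upperbound[OF \<Phi>_lim] eventually_sequentiallyI[of k]) auto
  have \<Phi>_decay: "(\<lambda>k. real k ^ 5 * \<Phi> k) \<longlonglongrightarrow> 0"
  proof (rule Lim_null_comparison[OF _ tendsto_rabs_zero[OF H2a]])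
    have "\<forall>\<^sub>F k in sequentially. real k ^ 5 \<le> exp ((ln (real k))\<^sup>2)"
      by real_asymp
    then show "\<forall>\<^sub>F k in sequentially. norm (real k ^ 5 * \<Phi> k) \<le> \<bar>exp ((ln (real k))\<^sup>2) * \<Phi> k\<bar>"
      by eventually_elim (auto simp: abs_mult intro: mult_right_mono)
  qed

  have moment: "\<exists>K\<ge>0. \<forall>k\<ge>1. \<forall>x\<in>space S. integrable (P x) (\<lambda>\<omega>. f (X k \<omega>)) \<and>
      \<bar>(\<integral>\<omega>. f (X k \<omega>) \<partial>P x) - (\<integral>\<omega>. f (X 1 \<omega>) \<partial>(\<nu> \<bind> P))\<bar> \<le> K * \<Phi> k"
    if f: "f \<in> borel_measurable borel" "\<And>y. \<bar>f y\<bar> \<le> A * (1 + \<bar>y\<bar> ^ 3)" for f :: "real \<Rightarrow> real" and A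
  proof -
    let ?L = "\<integral>\<omega>. f (X 1 \<omega>) \<partial>(\<nu> \<bind> P)"
    obtain Cf where Cf: "\<forall>k\<ge>1. \<forall>x\<in>space S. integrable (P x) (\<lambda>\<omega>. f (X k \<omega>)) \<and>
        \<bar>(\<integral>\<omega>. f (X k \<omega>) \<partial>P x) - ?L\<bar> \<le> Cf * \<Phi> k"
      using H2c[OF f(1) integrable_exp_abs_cubic_growth[OF f]] by blast
    have "Cf * \<Phi> k \<le> \<bar>Cf\<bar> * \<Phi> k" if "1 \<le> k" for k
      using \<Phi>_nonneg[OF that] by (intro mult_right_mono) auto
    with Cf have "\<forall>k\<ge>1. \<forall>x\<in>space S. integrable (P x) (\<lambda>\<omega>. f (X k \<omega>)) \<and>
        \<bar>(\<integral>\<omega>. f (X k \<omega>) \<partial>P x) - ?L\<bar> \<le> \<bar>Cf\<bar> * \<Phi> k"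
      using order_trans by blast
    then show ?thesis
      using abs_ge_zero by blast
  qed

  have growth1: "\<bar>y\<bar> \<le> 1 * (1 + \<bar>y\<bar> ^ 3)" for y :: real
    using le_one_plus_cube[of "\<bar>y\<bar>"] by simp
  have growth3: "\<bar>\<bar>y - v\<bar> ^ 3\<bar> \<le> 8 * (1 + \<bar>v\<bar> ^ 3) * (1 + \<bar>y\<bar> ^ 3)" for y
  proof -
    have "\<bar>y - v\<bar> ^ 3 \<le> (2 * max \<bar>y\<bar> \<bar>v\<bar>) ^ 3"
      by (intro power_mono) auto
    also have "\<dots> = 8 * max \<bar>y\<bar> \<bar>v\<bar> ^ 3"
      by (simp add: power_mult_distrib)
    also have "\<dots> \<le> 8 * (1 + \<bar>v\<bar> ^ 3 + \<bar>y\<bar> ^ 3 + \<bar>v\<bar> ^ 3 * \<bar>y\<bar> ^ 3)"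
      by (auto simp: max_def intro!: add_nonneg_nonneg add_increasing2 add_increasing)
    finally show ?thesis
      by (simp add: algebra_simps)
  qed
  have growth2: "\<bar>(y - v)\<^sup>2\<bar> \<le> (1 + 8 * (1 + \<bar>v\<bar> ^ 3)) * (1 + \<bar>y\<bar> ^ 3)" for y
  proof -
    have "\<bar>(y - v)\<^sup>2\<bar> \<le> 1 + \<bar>y - v\<bar> ^ 3"
      using le_one_plus_cube(2)[of "\<bar>y - v\<bar>"] by simp
    also have "\<dots> \<le> (1 + \<bar>y\<bar> ^ 3) + 8 * (1 + \<bar>v\<bar> ^ 3) * (1 + \<bar>y\<bar> ^ 3)"
      using growth3[of y] by (intro add_mono) auto
    finally show ?thesis
      by (simp add: algebra_simps)
  qed

  define V where "V = (\<integral>\<omega>. (Y 1 \<omega>)\<^sup>2 \<partial>(\<nu> \<bind> P))"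
  define L where "L = (\<integral>\<omega>. \<bar>Y 1 \<omega>\<bar> ^ 3 \<partial>(\<nu> \<bind> P))"
  obtain K1 where K1: "0 \<le> K1" "\<And>k x. 1 \<le> k \<Longrightarrow> x \<in> space S \<Longrightarrow> integrable (P x) (X k)"
      "\<And>k x. 1 \<le> k \<Longrightarrow> x \<in> space S \<Longrightarrow> \<bar>(\<integral>\<omega>. X k \<omega> \<partial>P x) - v\<bar> \<le> K1 * \<Phi> k"
    using moment[OF _ growth1] H2b[of 1] by auto
  obtain K2 where K2: "0 \<le> K2" "\<And>k x. 1 \<le> k \<Longrightarrow> x \<in> space S \<Longrightarrow> integrable (P x) (\<lambda>\<omega>. (Y k \<omega>)\<^sup>2)"
      "\<And>k x. 1 \<le> k \<Longrightarrow> x \<in> space S \<Longrightarrow> \<bar>(\<integral>\<omega>. (Y k \<omega>)\<^sup>2 \<partial>P x) - V\<bar> \<le> K2 * \<Phi> k"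
    unfolding V_def Y_def using moment[OF _ growth2] by auto
  obtain K3 where K3: "0 \<le> K3" "\<And>k x. 1 \<le> k \<Longrightarrow> x \<in> space S \<Longrightarrow> integrable (P x) (\<lambda>\<omega>. \<bar>Y k \<omega>\<bar> ^ 3)"
      "\<And>k x. 1 \<le> k \<Longrightarrow> x \<in> space S \<Longrightarrow> \<bar>(\<integral>\<omega>. \<bar>Y k \<omega>\<bar> ^ 3 \<partial>P x) - L\<bar> \<le> K3 * \<Phi> k"
    unfolding L_def Y_def using moment[OF _ growth3] by auto

  define \<gamma> where "\<gamma> j = (if j = 0 then V else (\<integral>\<omega>. X 1 \<omega> * X (j + 1) \<omega> \<partial>(\<nu> \<bind> P)) - v\<^sup>2)" for j
  define K where "K = C + 2 * \<bar>v\<bar> * K1 + K1 + K2"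
  define r where "r k = K * \<Phi> k" for k
  define B where "B = max 1 (\<bar>L\<bar> + K3 * \<Phi> 1)"
  \<comment> \<open>The separation factor is an integer in the locale; rounding up only shrinks the set of admissible pairs.\<close>
  define d where "d = nat \<lceil>c\<rceil>"
  have K: "K1 \<le> K" "K2 \<le> K" "C + 2 * \<bar>v\<bar> * K1 \<le> K" "0 \<le> K"
    using K1(1) K2(1) C unfolding K_def by auto
  have r: "A * \<Phi> k \<le> r k" if "A \<le> K" "1 \<le> k" for A k
    unfolding r_def using that \<Phi>_nonneg by (intro mult_right_mono) auto

  have Y_int: "integrable (P x) (Y k)" if "1 \<le> k" "x \<in> space S" for k x
  proof -
    interpret prob_space "P x"
      by (rule P) fact
    show ?thesis
      unfolding Y_def using K1(2)[OF that] by auto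
  qed
  have YY_int: "integrable (P x) (\<lambda>\<omega>. Y k \<omega> * Y l \<omega>)" if "1 \<le> k" "1 \<le> l" "x \<in> space S" for k l x
  proof (rule Bochner_Integration.integrable_bound)
    show "integrable (P x) (\<lambda>\<omega>. (Y k \<omega>)\<^sup>2 + (Y l \<omega>)\<^sup>2)"
      using K2(2) that by auto
    have "\<bar>a * b\<bar> \<le> a\<^sup>2 + b\<^sup>2" for a b :: real
      using sum_squares_bound[of "\<bar>a\<bar>" "\<bar>b\<bar>"] mult_nonneg_nonneg[of "\<bar>a\<bar>" "\<bar>b\<bar>"]
      unfolding abs_mult power2_abs by linarith
    then show "AE \<omega> in P x. norm (Y k \<omega> * Y l \<omega>) \<le> norm ((Y k \<omega>)\<^sup>2 + (Y l \<omega>)\<^sup>2)"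
      by (intro AE_I2) (auto intro: order_trans[OF _ abs_ge_self])
  qed (use YP that in auto)

  have mean: "\<bar>\<integral>\<omega>. Y k \<omega> \<partial>P x\<bar> \<le> r k" if "1 \<le> k" "x \<in> space S" for k x
  proof -
    interpret prob_space "P x"
      by (rule P) fact
    have "(\<integral>\<omega>. Y k \<omega> \<partial>P x) = (\<integral>\<omega>. X k \<omega> \<partial>P x) - v"
      unfolding Y_def using K1(2)[OF that] by (simp add: prob_space)
    then show ?thesis
      using K1(3)[OF that] r[OF K(1) that(1)] by simp
  qed
  have cov: "\<bar>(\<integral>\<omega>. Y k \<omega> * Y (k + j) \<omega> \<partial>P x) - \<gamma> j\<bar> \<le> r k"
    if k: "1 \<le> k" "d * j \<le> k" and x: "x \<in> space S" for k j x
  proof (cases "j = 0")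
    case True
    then show ?thesis
      using K2(3)[OF k(1) x] r[OF K(2) k(1)] by (simp add: \<gamma>_def power2_eq_square)
  next
    case False
    interpret prob_space "P x"
      by (rule P) fact
    let ?E = "\<lambda>k. \<integral>\<omega>. X k \<omega> \<partial>P x" and ?C = "\<integral>\<omega>. X k \<omega> * X (k + j) \<omega> \<partial>P x"
    have X_int: "integrable (P x) (X k)" "integrable (P x) (X (k + j))"
      using K1(2) k x by auto
    have XX: "X k \<omega> * X (k + j) \<omega> = Y k \<omega> * Y (k + j) \<omega> + v * X k \<omega> + v * X (k + j) \<omega> - v\<^sup>2" for \<omega>
      unfolding Y_def by (simp add: algebra_simps power2_eq_square)
    have "?C = (\<integral>\<omega>. Y k \<omega> * Y (k + j) \<omega> \<partial>P x) + v * ?E k + v * ?E (k + j) - v\<^sup>2"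
      unfolding XX using YY_int[of k "k + j" x] X_int k x by (simp add: prob_space)
    then have "(\<integral>\<omega>. Y k \<omega> * Y (k + j) \<omega> \<partial>P x) - \<gamma> j
        = (?C - (\<integral>\<omega>. X 1 \<omega> * X (j + 1) \<omega> \<partial>(\<nu> \<bind> P))) - v * (?E k - v) - v * (?E (k + j) - v)"
      using False by (simp add: \<gamma>_def algebra_simps power2_eq_square)
    moreover have "\<bar>?C - (\<integral>\<omega>. X 1 \<omega> * X (j + 1) \<omega> \<partial>(\<nu> \<bind> P))\<bar> \<le> C * \<Phi> k"
    proof (rule H2d[OF k(1) _ _ x])
      have "c * real j \<le> real d * real j"
        unfolding d_def by (intro mult_right_mono) linarith+
      also have "\<dots> \<le> real k"
        using k(2) by (simp flip: of_nat_mult)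
      finally show "c * real j \<le> real k" .
    qed (use False in simp)
    moreover have "\<bar>v * (?E k - v)\<bar> \<le> \<bar>v\<bar> * (K1 * \<Phi> k)"
      unfolding abs_mult using K1(3)[OF k(1) x] by (intro mult_left_mono) auto
    moreover have "\<bar>v * (?E (k + j) - v)\<bar> \<le> \<bar>v\<bar> * (K1 * \<Phi> k)"
      unfolding abs_mult using K1(3)[of "k + j" x] x k(1) mult_left_mono[OF \<Phi>_mono[of k "k + j"] K1(1)]
      by (intro mult_left_mono) auto
    ultimately have "\<bar>(\<integral>\<omega>. Y k \<omega> * Y (k + j) \<omega> \<partial>P x) - \<gamma> j\<bar> \<le> C * \<Phi> k + \<bar>v\<bar> * (K1 * \<Phi> k) + \<bar>v\<bar> * (K1 * \<Phi> k)"
      by linarith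
    also have "\<dots> = (C + 2 * \<bar>v\<bar> * K1) * \<Phi> k"
      by (simp add: algebra_simps)
    finally show ?thesis
      using r[OF K(3) k(1)] by linarith
  qed

  \<comment> \<open>By the Markov property, the conditional mean given the past up to time \<open>m\<close> of a block that starts at
    time \<open>m + 1\<close> is its mean under another initial state, where the block starts at time \<open>1\<close>.\<close>
  have restart: "AE \<omega> in P x. \<bar>real_cond_exp (P x) (F m) (\<lambda>\<omega>. f (block X (m + 1) n \<omega>)) \<omega> - a\<bar> \<le> e"
    if n: "1 \<le> n" and f: "f \<in> borel_measurable (borel_pow n)"
      and f_int: "\<And>y. y \<in> space S \<Longrightarrow> integrable (P y) (\<lambda>\<omega>. f (block X 1 n \<omega>))"
      and f_bd: "\<And>y. y \<in> space S \<Longrightarrow> \<bar>(\<integral>\<omega>. f (block X 1 n \<omega>) \<partial>P y) - a\<bar> \<le> e"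
      and x: "x \<in> space S" for n f m x a e
  proof -
    have bdd: "bdd_above ((\<lambda>y. \<integral>\<omega>. f (block X 1 n \<omega>) \<partial>P y) ` space S)"
      using f_bd by (intro bdd_aboveI[of _ "a + e"]) (fastforce simp: abs_le_iff)
    have "AE \<omega> in P x. real_cond_exp (P x) (F m) (\<lambda>\<omega>. f (block X (m + 1) n \<omega>)) \<omega>
        = (\<integral>\<omega>'. f (block X 1 n \<omega>') \<partial>P (Z (real m) \<omega>))"
      using H1c[OF _ n f f_int bdd x, of "m + 1"] unfolding F_def by simp
    then show ?thesis
      using AE_space
    proof eventually_elim
      case (elim \<omega>)
      have "Z (real m) \<omega> \<in> space S"
        using measurable_space[OF process_measurable] elim(2) P(3)[OF x] by simp
      then show ?case
        using f_bd elim(1) by simp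
    qed
  qed

  have wds: "weakly_dependent_sequence (P x) F Y \<gamma> r B d" if x: "x \<in> space S" for x
  proof -
    interpret prob_space "P x"
      by (rule P) fact
    show ?thesis
    proof
      show "subalgebra (P x) (F m)" for m
        by (rule F) fact
      show "Y i \<in> borel_measurable (F m)" if "1 \<le> i" "i \<le> m" for i m
        by (rule adapted) fact+
      show "integrable (P x) (\<lambda>\<omega>. \<bar>Y i \<omega>\<bar> ^ 3)" if "1 \<le> i" for i
        by (rule K3(2)) fact+
      show "expectation (\<lambda>\<omega>. \<bar>Y i \<omega>\<bar> ^ 3) \<le> B" if "1 \<le> i" for i
        using K3(3)[OF that x] mult_left_mono[OF \<Phi>_mono[OF order_refl that] K3(1)] unfolding B_def by auto
      show "1 \<le> B"
        unfolding B_def by simp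
      show "1 \<le> d"
        using c unfolding d_def by linarith
      show "AE \<omega> in P x. \<bar>real_cond_exp (P x) (F m) (Y (m + k)) \<omega>\<bar> \<le> r k" if k: "1 \<le> k" for m k
      proof -
        let ?f = "\<lambda>y :: nat \<Rightarrow> real. y (k - 1) - v"
        have block: "?f (block X l k \<omega>) = Y (l + k - 1) \<omega>" for l \<omega>
          using k unfolding block_def Y_def by simp
        have "?f \<in> borel_measurable (borel_pow k)"
          using k by (intro borel_measurable_diff measurable_component_singleton) auto
        from restart[OF k this, of 0 "r k" x m] show ?thesis
          unfolding block using Y_int[OF k] mean[OF k] x by simp
      qed
      show "AE \<omega> in P x. \<bar>real_cond_exp (P x) (F m) (\<lambda>\<omega>. Y (m + k) \<omega> * Y (m + k + j) \<omega>) \<omega> - \<gamma> j\<bar> \<le> r k"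
        if k: "1 \<le> k" "d * j \<le> k" for m k j
      proof -
        let ?f = "\<lambda>y :: nat \<Rightarrow> real. (y (k - 1) - v) * (y (k + j - 1) - v)"
        have "k - 1 < k + j" "k + j - 1 < k + j"
          using k by auto
        then have block: "?f (block X l (k + j) \<omega>) = Y (l + k - 1) \<omega> * Y (l + k + j - 1) \<omega>" for l \<omega>
          using k unfolding block_def Y_def by (simp add: add.assoc)
        have "?f \<in> borel_measurable (borel_pow (k + j))"
          using k by (intro borel_measurable_times borel_measurable_diff measurable_component_singleton) auto
        from restart[OF _ this, of "\<gamma> j" "r k" x m] show ?thesis
          unfolding block using YY_int[of k "k + j"] cov[OF k] k x by simp
      qed
      show "antimono_on {1..} r"
        unfolding r_def using \<Phi>_mono K(4) by (auto simp: monotone_on_def intro: mult_left_mono)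
      show "0 \<le> r k" if "1 \<le> k" for k
        unfolding r_def using \<Phi>_nonneg[OF that] K(4) by simp
      show "(\<lambda>k. real k ^ 5 * r k) \<longlonglongrightarrow> 0"
        unfolding r_def using tendsto_mult_left[OF \<Phi>_decay, of K] by (simp add: mult_ac)
    qed
  qed

  \<comment> \<open>The variance is a function of \<open>\<gamma>\<close> alone; any one initial state shows that it is nonnegative.\<close>
  obtain x0 where x0: "x0 \<in> space S"
    using prob_space.not_empty[OF \<nu>(1)] sets_eq_imp_space_eq[OF \<nu>(2)] by auto
  interpret x0: weakly_dependent_sequence "P x0" F Y \<gamma> r B d
    by (rule wds) fact
  let ?s = "sqrt x0.asymptotic_variance"
  have sum: "(\<Sum>i=1..n. X i \<omega>) - v * real n = (\<Sum>i=1..n. Y i \<omega>)" for n \<omega>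
    unfolding Y_def by (simp add: sum_subtractf)
  have "weak_conv_m (\<lambda>n. distr (P x) borel (\<lambda>\<omega>. ((\<Sum>i=1..n. X i \<omega>) - v * real n) / sqrt (real n))) (normal_law 0 ?s)"
    if "x \<in> space S" for x
    unfolding sum using weakly_dependent_sequence.central_limit[OF wds[OF that]] .
  then show ?thesis
    using x0.asymptotic_variance_nonneg by (intro exI[of _ ?s]) auto
qed

end
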